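(* Let $n=2$, $\delta\in(0,1/2)$, let $g$ be admissible, and let $X$ be the market model driven by $g$ (with $\mu_1(0)\in(\delta,1-\delta)$). Then the market is $\delta$-diverse if and only if $$\int_{1/2}^{1-\delta}\exp\Big(\int_{1/2}^{y}A_2(z)g(z)\,dz\Big)dy=\infty .$$
   Context: Fix an integer $n\ge 2$ and $\delta\in(0,1)$. A continuous function $g:(0,1-\delta)\to\mathbb{R}$ is called admissible if $\lim_{x\uparrow 1-\delta}g(x)=+\infty$. Let $W=(W_1,\dots,W_n)$ be an $n$-dimensional standard Brownian motion on a filtered probability space whose filtration satisfies the usual conditions and is generated by $W$. The market model driven by $g$ is an $(0,\infty)^n$-valued continuous process $X(t)=(X_1(t),\dots,X_n(t))$ satisfying $$d\log X_i(t)=-g(\mu_i(t))\,dt+dW_i(t),\qquad i=1,\dots,n,$$ where $S(t)=X_1(t)+\dots+X_n(t)$ and $\mu_i(t)=X_i(t)/S(t)$ are the market weights; the process is considered up to the first time some $\mu_i$ reaches $1-\delta$ or some $X_i$ reaches $0$. The market is called $\delta$-diverse if almost surely $\mu_i(t)<1-\delta$ for all $i=1,\dots,n$ and all $t\ge 0$ (i.e. almost surely no market weight ever reaches $1-\delta$ and no capitalization ever reaches $0$). Define $A_1(x)=\frac{2}{1+(n-1)^{-1}}\cdot\frac{1}{x(1-x)}$, $A_2(x)=\frac{1}{x(1-x)}$, $a_1=A_1(1-\delta)$, $a_2=A_2(1-\delta)$. *)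

theory Defs
  imports "HOL-Probability.Probability"
begin

definition admissible :: "real \<Rightarrow> (real \<Rightarrow> real) \<Rightarrow> bool" where
  "admissible \<delta> g \<longleftrightarrow> continuous_on {0<..<1 - \<delta>} g \<and> filterlim g at_top (at_left (1 - \<delta>))"

definition A2 :: "real \<Rightarrow> real" where
  "A2 x = 1 / (x * (1 - x))"

definition std_BM2 :: "'a measure \<Rightarrow> (nat \<Rightarrow> real \<Rightarrow> 'a \<Rightarrow> real) \<Rightarrow> bool" where
  "std_BM2 M W \<longleftrightarrow> prob_space M
    \<and> (\<forall>i\<in>{1,2}. \<forall>t\<ge>0. W i t \<in> borel_measurable M)
    \<and> (AE \<omega> in M. \<forall>i\<in>{1,2}. W i 0 \<omega> = 0 \<and> continuous_on {0..} (\<lambda>t. W i t \<omega>))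
    \<and> (\<forall>(ts :: nat \<Rightarrow> real) (k :: nat). ts 0 = 0 \<and> (\<forall>j<k. ts j < ts (Suc j)) \<longrightarrow>
         prob_space.indep_vars M (\<lambda>_. borel)
            (\<lambda>(i, j) \<omega>. W i (ts (Suc j)) \<omega> - W i (ts j) \<omega>) ({1,2} \<times> {..<k})
       \<and> (\<forall>i\<in>{1,2}. \<forall>j<k. distributed M lborel (\<lambda>\<omega>. W i (ts (Suc j)) \<omega> - W i (ts j) \<omega>)
              (\<lambda>x. ennreal (normal_density 0 (sqrt (ts (Suc j) - ts j)) x))))"

definition mu :: "(nat \<Rightarrow> real \<Rightarrow> 'a \<Rightarrow> real) \<Rightarrow> nat \<Rightarrow> real \<Rightarrow> 'a \<Rightarrow> real" where
  "mu X i t \<omega> = X i t \<omega> / (X 1 t \<omega> + X 2 t \<omega>)"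

definition market_domain :: "real \<Rightarrow> (real \<times> real) set" where
  "market_domain \<delta> = {(a, b). 0 < a \<and> 0 < b \<and> a / (a + b) < 1 - \<delta> \<and> b / (a + b) < 1 - \<delta>}"

text \<open>X (with n = 2, deterministic initial value x0) is the market model driven by g,
  defined up to its lifetime tau: on [0, tau) it stays in the domain, has continuous paths and
  satisfies log X_i(t) = log x0_i - int_0^t g(mu_i(s)) ds + W_i(t); if tau is finite the path
  leaves every compact subset of the domain before tau (i.e. reaches the boundary at tau).\<close>
definition market_solution :: "'a measure \<Rightarrow> real \<Rightarrow> (real \<Rightarrow> real) \<Rightarrow> (nat \<Rightarrow> real \<Rightarrow> 'a \<Rightarrow> real)
    \<Rightarrow> (nat \<Rightarrow> real) \<Rightarrow> (nat \<Rightarrow> real \<Rightarrow> 'a \<Rightarrow> real) \<Rightarrow> ('a \<Rightarrow> ereal) \<Rightarrow> bool" where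
  "market_solution M \<delta> g W x0 X \<tau> \<longleftrightarrow>
    (AE \<omega> in M. 0 < \<tau> \<omega>
      \<and> (\<forall>i\<in>{1,2}. X i 0 \<omega> = x0 i)
      \<and> (\<forall>t. 0 \<le> t \<and> ereal t < \<tau> \<omega> \<longrightarrow> (X 1 t \<omega>, X 2 t \<omega>) \<in> market_domain \<delta>)
      \<and> (\<forall>i\<in>{1,2}. continuous_on {t. 0 \<le> t \<and> ereal t < \<tau> \<omega>} (\<lambda>t. X i t \<omega>))
      \<and> (\<forall>i\<in>{1,2}. \<forall>t. 0 \<le> t \<and> ereal t < \<tau> \<omega> \<longrightarrow>
            ln (X i t \<omega>) = ln (x0 i) - integral {0..t} (\<lambda>s. g (mu X i s \<omega>)) + W i t \<omega>)
      \<and> (\<tau> \<omega> < \<infinity> \<longrightarrow> (\<forall>K. compact K \<and> K \<subseteq> market_domain \<delta> \<longrightarrow>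
            (\<exists>t. 0 \<le> t \<and> ereal t < \<tau> \<omega> \<and> (X 1 t \<omega>, X 2 t \<omega>) \<notin> K))))"

definition delta_diverse :: "'a measure \<Rightarrow> real \<Rightarrow> (nat \<Rightarrow> real \<Rightarrow> 'a \<Rightarrow> real) \<Rightarrow> ('a \<Rightarrow> ereal) \<Rightarrow> bool" where
  "delta_diverse M \<delta> X \<tau> \<longleftrightarrow>
    (AE \<omega> in M. \<forall>t\<ge>0. ereal t < \<tau> \<omega> \<and> (\<forall>i\<in>{1,2}. 0 < X i t \<omega> \<and> mu X i t \<omega> < 1 - \<delta>))"

end

theory Submission
  imports Defs
begin

text \<open>
  The log-ratio \<open>Y = ln X\<^sub>1 - ln X\<^sub>2\<close> solves \<open>Y = y\<^sub>0 - \<integral> h(Y) ds + N\<close> with \<open>N = W\<^sub>1 - W\<^sub>2\<close> and an odd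
  drift \<open>h\<close> on \<open>(-L, L)\<close>, where \<open>L = ln ((1 - \<delta>) / \<delta>)\<close>, and the integral in the theorem is, up to bounded factors,
  the scale function of \<open>Y\<close> at \<open>L\<close>. Feller's test is carried out without stochastic calculus, with a function
  \<open>f\<close> satisfying \<open>f'' - (h - 1) f' = 1\<close>. Instead of the Ito formula, \<open>f\<close> is evaluated along stopped Euler
  chains driven by the increments of \<open>N\<close>: a Taylor expansion and the independence of the increments give
  \<open>E f(Z) = f(y\<^sub>0) + E(lifetime) + o(1)\<close>. Since the solution need not be adapted or unique, it is compared path by
  path: for a fine mesh, \<open>Y\<close> stays below the chain with drift \<open>-(h - 1)\<close>. If the integral diverges, then \<open>f\<close> can
  be chosen nonnegative and tending to infinity at both ends, so chains leave large intervals with small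
  probability, which confines \<open>Y\<close> and, by symmetry, \<open>-Y\<close>. If the integral converges, then \<open>f\<close> can be chosen bounded
  near \<open>-L\<close>, so chains get arbitrarily close to \<open>-L\<close> in bounded time with a probability bounded below, and \<open>Y\<close> with them.
\<close>

section \<open>Taylor expansion of one Euler step\<close>

text \<open>\<open>N\<close> has variance \<open>2 * t\<close>, so \<open>Y\<close> has generator
  \<open>f'' - h f'\<close>. With \<open>p' = h - 1\<close>, solutions of
  \<open>f'' - (h - 1) f' = 1\<close> are iterated integrals of \<open>exp p\<close> and
  \<open>exp (- p)\<close>, the nested integral of Feller's test. It reduces to the single integral
  of the theorem because \<open>g\<close> tends to +infinity at \<open>1 - \<delta>\<close>: this
  bounds \<open>p\<close> below, hence \<open>exp (- p)\<close> above, so only the growth of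
  \<open>exp p\<close> matters. As \<open>h\<close> is merely continuous, no Lipschitz estimate
  keeps chain and solution together; a strict gap between their drifts still orders them. The gap 1
  does not affect the criterion: it multiplies the scale density by \<open>exp (- y)\<close>, which
  is bounded above and away from 0 on \<open>(-L, L)\<close>. The comparison bounds \<open>Y\<close>
  from above only. Hence explosion is established at the lower end, while nonexplosion there needs
  the reflected equation. The mesh from which the comparison holds depends on the path, and nothing
  makes it measurable. Probabilities are therefore estimated mesh by mesh and for chains only;
  limit-inferior arguments transfer them to single paths.\<close>

abbreviation clamped :: "(real \<Rightarrow> real) \<Rightarrow> real \<Rightarrow> real \<Rightarrow> real \<Rightarrow> real" where
  "clamped f a b \<equiv> \<lambda>y. f (max a (min b y))"

lemma continuous_on_Icc_bounded:
  fixes k :: "real \<Rightarrow> real"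
  assumes "continuous_on {a..b} k"
  shows "\<exists>C\<ge>0. \<forall>x\<in>{a..b}. \<bar>k x\<bar> \<le> C"
proof -
  have "bounded (k ` {a..b})" using assms by (intro compact_imp_bounded compact_continuous_image) auto
  then obtain C where "0 < C" "\<forall>x\<in>k ` {a..b}. norm x \<le> C" by (auto simp: bounded_pos)
  then show ?thesis by (intro exI[of _ C]) auto
qed

text \<open>Steps \<open>z\<close> of a chain are unbounded while \<open>f\<close> is under control
  only on \<open>[a, b]\<close>; hence the clamping. For small \<open>z\<close>, uniform continuity
  of \<open>v\<close> bounds the remainder by \<open>e * z\<^sup>2\<close>. For large
  \<open>z\<close>, every term is at most a multiple of \<open>z ^ 4\<close>, whose mean is of order
  \<open>D\<^sup>2\<close> for a normal step of variance \<open>2 * D\<close>, negligible over about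
  \<open>1 / D\<close> steps.\<close>

lemma taylor_clamped:
  fixes f u v :: "real \<Rightarrow> real"
  assumes f: "\<And>y. y \<in> {a..b} \<Longrightarrow> (f has_real_derivative u y) (at y)"
    and u: "\<And>y. y \<in> {a..b} \<Longrightarrow> (u has_real_derivative v y) (at y)"
    and v: "continuous_on {a..b} v"
    and ab: "a < \<alpha>" "\<alpha> \<le> \<beta>" "\<beta> < b" and e: "0 < e"
  shows "\<exists>K\<ge>0. \<forall>y\<in>{\<alpha>..\<beta>}. \<forall>z. \<bar>clamped f a b (y + z) - f y - u y * z - v y / 2 * z\<^sup>2\<bar> \<le> e * z\<^sup>2 + K * z ^ 4"
proof -
  have "uniformly_continuous_on {a..b} v"
    using v by (intro compact_uniformly_continuous) auto
  then obtain d0 where d0: "0 < d0"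
    "\<And>x y. x \<in> {a..b} \<Longrightarrow> y \<in> {a..b} \<Longrightarrow> dist y x < d0 \<Longrightarrow> dist (v y) (v x) < 2 * e"
    using e unfolding uniformly_continuous_on_def by (metis mult_pos_pos zero_less_numeral)
  \<comment> \<open>Steps shorter than \<open>d\<close> stay in \<open>[a, b]\<close>, so clamping
    is inactive, and they move \<open>v\<close> by less than \<open>2 * e\<close>.\<close>
  define d where "d = min d0 (min (\<alpha> - a) (b - \<beta>))"
  have d: "0 < d" "d \<le> d0" "d \<le> \<alpha> - a" "d \<le> b - \<beta>"
    using d0 ab by (auto simp: d_def)
  have cf: "continuous_on {a..b} f" and cu: "continuous_on {a..b} u"
    using f u by (blast intro: continuous_at_imp_continuous_on DERIV_isCont)+
  have abs4: "\<bar>p - q - r - s\<bar> \<le> p' + q' + r' + s'"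
    if "\<bar>p\<bar> \<le> p'" "\<bar>q\<bar> \<le> q'" "\<bar>r\<bar> \<le> r'" "\<bar>s\<bar> \<le> s'" for p q r s p' q' r' s' :: real
    using that by linarith
  obtain C0 where C0: "C0 \<ge> 0" "\<And>x. x \<in> {a..b} \<Longrightarrow> \<bar>f x\<bar> \<le> C0" using continuous_on_Icc_bounded[OF cf] by blast
  obtain C1 where C1: "C1 \<ge> 0" "\<And>x. x \<in> {a..b} \<Longrightarrow> \<bar>u x\<bar> \<le> C1" using continuous_on_Icc_bounded[OF cu] by blast
  obtain C2 where C2: "C2 \<ge> 0" "\<And>x. x \<in> {a..b} \<Longrightarrow> \<bar>v x\<bar> \<le> C2" using continuous_on_Icc_bounded[OF v] by blast
  \<comment> \<open>The powers of \<open>d\<close> come from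
    \<open>1 \<le> \<bar>z\<bar> / d\<close>, which raises each lower power of \<open>z\<close> to
    the fourth.\<close>
  define K where "K = 2 * C0 / d ^ 4 + C1 / d ^ 3 + C2 / d\<^sup>2"
  have K: "K \<ge> 0" using C0 C1 C2 d by (auto simp: K_def)
  show ?thesis
  proof (intro exI[of _ K] conjI K ballI allI)
    fix y z :: real assume y: "y \<in> {\<alpha>..\<beta>}"
    have yab: "y \<in> {a..b}" using y ab by auto
    show "\<bar>clamped f a b (y + z) - f y - u y * z - v y / 2 * z\<^sup>2\<bar> \<le> e * z\<^sup>2 + K * z ^ 4"
    proof (cases "\<bar>z\<bar> < d")
      case True
      have yz: "y + z \<in> {a..b}" using y d True by auto
      then have cl: "clamped f a b (y + z) = f (y + z)" by (simp add: min_absorb2 max_absorb2)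
      show ?thesis
      proof (cases "z = 0")
        case True
        then show ?thesis using cl by simp
      next
        case False
        define df where "df m = (if m = 0 then f else if m = 1 then u else v)" for m :: nat
        have "\<exists>t. (if y + z < y then y + z < t \<and> t < y else y < t \<and> t < y + z) \<and>
          f (y + z) = (\<Sum>m<2. (df m y / fact m) * (y + z - y) ^ m)
            + (df 2 t / fact 2) * (y + z - y) ^ 2"
          using f u yab yz False by (intro Taylor[where a = a and b = b]) (auto simp: df_def less_2_cases_iff)
        then obtain t where t: "if z < 0 then y + z < t \<and> t < y else y < t \<and> t < y + z"
          and eq: "f (y + z) = f y + u y * z + v t / 2 * z\<^sup>2"
          by (auto simp: df_def numeral_2_eq_2)
        have "t \<in> {a..b}" "dist t y < d0"
          using t yab yz True d by (auto simp: dist_real_def split: if_splits)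
        then have "dist (v t) (v y) < 2 * e" using d0(2) yab by blast
        then have "\<bar>(v t - v y) / 2\<bar> \<le> e" by (simp add: dist_real_def)
        then have "\<bar>(v t - v y) / 2\<bar> * z\<^sup>2 \<le> e * z\<^sup>2" by (intro mult_right_mono) auto
        moreover have "clamped f a b (y + z) - f y - u y * z - v y / 2 * z\<^sup>2 = (v t - v y) / 2 * z\<^sup>2"
          unfolding cl eq by (simp add: field_simps)
        moreover have "\<bar>(v t - v y) / 2 * z\<^sup>2\<bar> = \<bar>(v t - v y) / 2\<bar> * z\<^sup>2"
          unfolding abs_mult by simp
        ultimately have "\<bar>clamped f a b (y + z) - f y - u y * z - v y / 2 * z\<^sup>2\<bar> \<le> e * z\<^sup>2"
          by metis
        moreover have "0 \<le> K * z ^ 4" using K by simp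
        ultimately show ?thesis by linarith
      qed
    next
      case False
      then have zd: "1 \<le> \<bar>z\<bar> / d" using d by simp
      have z4: "\<bar>z\<bar> ^ 4 = z ^ 4" by (simp add: power_even_abs)
      have z2: "\<bar>z\<bar> ^ 2 = z ^ 2" by simp
      have p4: "1 \<le> z ^ 4 / d ^ 4"
        using power_mono[OF zd, of 4] by (simp add: power_divide z4)
      have p3: "\<bar>z\<bar> \<le> z ^ 4 / d ^ 3"
      proof -
        have "\<bar>z\<bar> * 1 \<le> \<bar>z\<bar> * (\<bar>z\<bar> / d) ^ 3" using power_mono[OF zd, of 3] by (intro mult_left_mono) auto
        also have "\<dots> = z ^ 4 / d ^ 3" unfolding z4[symmetric] by (simp add: power_divide power3_eq_cube power4_eq_xxxx)
        finally show ?thesis by simp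
      qed
      have p2: "z\<^sup>2 \<le> z ^ 4 / d\<^sup>2"
      proof -
        have "\<bar>z\<bar>\<^sup>2 * 1 \<le> \<bar>z\<bar>\<^sup>2 * (\<bar>z\<bar> / d) ^ 2" using power_mono[OF zd, of 2] by (intro mult_left_mono) auto
        also have "\<dots> = z ^ 4 / d ^ 2" unfolding z4[symmetric] by (simp add: power_divide power2_eq_square power4_eq_xxxx)
        finally show ?thesis by simp
      qed
      have "max a (min b (y + z)) \<in> {a..b}" using ab by auto
      then have "\<bar>clamped f a b (y + z)\<bar> \<le> C0" by (rule C0)
      moreover have "\<bar>f y\<bar> \<le> C0" using C0 yab by blast
      moreover have "\<bar>u y * z\<bar> \<le> C1 * \<bar>z\<bar>" using C1(2)[OF yab] by (simp add: abs_mult mult_right_mono)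
      moreover have "\<bar>v y / 2 * z\<^sup>2\<bar> \<le> C2 * z\<^sup>2"
        unfolding abs_mult using C2(1) C2(2)[OF yab] by (intro mult_mono) auto
      ultimately have "\<bar>clamped f a b (y + z) - f y - u y * z - v y / 2 * z\<^sup>2\<bar>
          \<le> C0 + C0 + C1 * \<bar>z\<bar> + C2 * z\<^sup>2" by (rule abs4)
      also have "\<dots> = 2 * C0 * 1 + C1 * \<bar>z\<bar> + C2 * z\<^sup>2" by simp
      also have "\<dots> \<le> 2 * C0 * (z ^ 4 / d ^ 4) + C1 * (z ^ 4 / d ^ 3) + C2 * (z ^ 4 / d\<^sup>2)"
        using C0 C1 C2 p4 p3 p2 by (intro add_mono mult_left_mono) auto
      also have "\<dots> = K * z ^ 4" by (simp add: K_def field_simps)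
      also have "\<dots> \<le> e * z\<^sup>2 + K * z ^ 4" using e by simp
      finally show ?thesis .
    qed
  qed
qed

text \<open>The part linear in \<open>x\<close> is kept exactly, cross term included, because its
  mean vanishes; only the square of the drift part goes into the error of order
  \<open>D\<^sup>2\<close>. With \<open>x\<^sup>2\<close> of mean \<open>2 * D\<close>, the explicit
  terms average to \<open>D * (v y - H y * u y)\<close>.\<close>

lemma euler_step_expansion:
  fixes f u v H :: "real \<Rightarrow> real"
  assumes f: "\<And>y. y \<in> {a..b} \<Longrightarrow> (f has_real_derivative u y) (at y)"
    and u: "\<And>y. y \<in> {a..b} \<Longrightarrow> (u has_real_derivative v y) (at y)"
    and v: "continuous_on {a..b} v"
    and H: "continuous_on {\<alpha>..\<beta>} H"
    and ab: "a < \<alpha>" "\<alpha> \<le> \<beta>" "\<beta> < b" and e: "0 < e"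
  shows "\<exists>K\<ge>0. \<forall>y\<in>{\<alpha>..\<beta>}. \<forall>x. \<forall>D\<in>{0..1}.
    \<bar>clamped f a b (y + (x - H y * D)) - clamped f a b y
      - (- (u y * H y * D) + (u y - v y * H y * D) * x + v y / 2 * x\<^sup>2)\<bar> \<le> e * x\<^sup>2 + K * x ^ 4 + K * D\<^sup>2"
proof -
  \<comment> \<open>Half of \<open>e\<close>, since squaring \<open>z = x - w\<close> costs a factor
    2 in front of \<open>x\<^sup>2\<close>.\<close>
  from taylor_clamped[OF f u v ab, of "e/2"] e obtain K where K: "K \<ge> 0"
    and T: "\<And>y z. y \<in> {\<alpha>..\<beta>} \<Longrightarrow>
      \<bar>clamped f a b (y + z) - f y - u y * z - v y / 2 * z\<^sup>2\<bar> \<le> e / 2 * z\<^sup>2 + K * z ^ 4"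
    by auto
  obtain B where B0: "0 \<le> B" and B: "\<And>y. y \<in> {\<alpha>..\<beta>} \<Longrightarrow> \<bar>H y\<bar> \<le> B"
    using continuous_on_Icc_bounded[OF H] by blast
  obtain C where C0: "0 \<le> C" and C: "\<And>y. y \<in> {a..b} \<Longrightarrow> \<bar>v y\<bar> \<le> C"
    using continuous_on_Icc_bounded[OF v] by blast
  define K' where "K' = 8 * K + C / 2 * B\<^sup>2 + e * B\<^sup>2 + 8 * K * B ^ 4"
  have K'0: "0 \<le> K'" using K B0 C0 e by (auto simp: K'_def)
  have K'1: "8 * K \<le> K'" using K B0 C0 e by (auto simp: K'_def)
  show ?thesis
  proof (intro exI[of _ K'] conjI K'0 ballI allI)
    fix y x D :: real assume y: "y \<in> {\<alpha>..\<beta>}" and D: "D \<in> {0..1}"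
    define w where "w = H y * D"
    define z where "z = x - w"
    have "\<bar>w\<bar> = \<bar>H y\<bar> * D" using D by (simp add: w_def abs_mult)
    also have "\<dots> \<le> B * D" using D B[OF y] by (intro mult_right_mono) auto
    finally have w1: "\<bar>w\<bar> \<le> B * D" .
    have w2: "w\<^sup>2 \<le> B\<^sup>2 * D\<^sup>2" using power_mono[OF w1, of 2] by (simp add: power_mult_distrib)
    have "w ^ 4 \<le> B ^ 4 * D ^ 4" using power_mono[OF w1, of 4] by (simp add: power_mult_distrib power_even_abs)
    also have "\<dots> \<le> B ^ 4 * D\<^sup>2" using D by (intro mult_left_mono power_decreasing) auto
    finally have w4: "w ^ 4 \<le> B ^ 4 * D\<^sup>2" .
    have z2: "z\<^sup>2 \<le> 2 * x\<^sup>2 + 2 * w\<^sup>2"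
    proof -
      have "0 \<le> (x + w)\<^sup>2" by simp
      then show ?thesis by (simp add: z_def power2_eq_square algebra_simps)
    qed
    have z4: "z ^ 4 \<le> 8 * x ^ 4 + 8 * w ^ 4"
    proof -
      have "z ^ 4 = (z\<^sup>2)\<^sup>2" by simp
      also have "\<dots> \<le> (2 * x\<^sup>2 + 2 * w\<^sup>2)\<^sup>2" by (intro power_mono z2) auto
      also have "\<dots> \<le> 8 * (x\<^sup>2)\<^sup>2 + 8 * (w\<^sup>2)\<^sup>2"
      proof -
        have "0 \<le> (x\<^sup>2 - w\<^sup>2)\<^sup>2" by simp
        then show ?thesis by (simp add: power2_eq_square algebra_simps)
      qed
      finally show ?thesis by simp
    qed
    have "y \<in> {a..b}" using y ab by auto
    then have vy: "\<bar>v y / 2\<bar> \<le> C / 2" using C by simp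
    have vw: "\<bar>v y / 2 * w\<^sup>2\<bar> \<le> C / 2 * (B\<^sup>2 * D\<^sup>2)"
      unfolding abs_mult using vy w2 C0 by (intro mult_mono) auto
    have cy: "clamped f a b y = f y" using y ab by (simp add: max_def min_def)
    have "clamped f a b (y + (x - H y * D)) - clamped f a b y
        - (- (u y * H y * D) + (u y - v y * H y * D) * x + v y / 2 * x\<^sup>2)
      = (clamped f a b (y + z) - f y - u y * z - v y / 2 * z\<^sup>2) + v y / 2 * w\<^sup>2"
      unfolding cy by (simp add: z_def w_def field_simps power2_eq_square)
    then have "\<bar>clamped f a b (y + (x - H y * D)) - clamped f a b y
        - (- (u y * H y * D) + (u y - v y * H y * D) * x + v y / 2 * x\<^sup>2)\<bar>
      \<le> (e / 2 * z\<^sup>2 + K * z ^ 4) + C / 2 * (B\<^sup>2 * D\<^sup>2)"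
      using abs_triangle_ineq[of "clamped f a b (y + z) - f y - u y * z - v y / 2 * z\<^sup>2" "v y / 2 * w\<^sup>2"]
        add_mono[OF T[OF y, of z] vw] by (simp only: order_trans)
    also have "\<dots> \<le> e / 2 * (2 * x\<^sup>2 + 2 * (B\<^sup>2 * D\<^sup>2)) + K * (8 * x ^ 4 + 8 * (B ^ 4 * D\<^sup>2)) + C / 2 * (B\<^sup>2 * D\<^sup>2)"
      using e K C0 z2 z4 w2 w4 by (intro add_mono mult_left_mono) auto
    also have "\<dots> = e * x\<^sup>2 + 8 * K * x ^ 4 + (C / 2 * B\<^sup>2 + e * B\<^sup>2 + 8 * K * B ^ 4) * D\<^sup>2"
      by (simp add: field_simps)
    also have "\<dots> \<le> e * x\<^sup>2 + K' * x ^ 4 + K' * D\<^sup>2"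
      using K B0 C0 e by (intro add_mono mult_right_mono K'1) (auto simp: K'_def)
    finally show "\<bar>clamped f a b (y + (x - H y * D)) - clamped f a b y
        - (- (u y * H y * D) + (u y - v y * H y * D) * x + v y / 2 * x\<^sup>2)\<bar> \<le> e * x\<^sup>2 + K' * x ^ 4 + K' * D\<^sup>2" .
  qed
qed

section \<open>Stopped Euler chains\<close>

text \<open>The chain is frozen, not projected, at its first value outside
  \<open>[\<alpha>, \<beta>]\<close>, so the terminal value tells on which side the exit took place.
  The increments enter as a plain sequence \<open>x\<close>, which serves both the pathwise
  comparison and the expectations.\<close>

primrec euler :: "(real \<Rightarrow> real) \<Rightarrow> real \<Rightarrow> real \<Rightarrow> real \<Rightarrow> real \<Rightarrow> (nat \<Rightarrow> real) \<Rightarrow> nat \<Rightarrow> real" where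
  "euler H \<alpha> \<beta> D y x 0 = y"
| "euler H \<alpha> \<beta> D y x (Suc k) =
    (let z = euler H \<alpha> \<beta> D y x k in z + indicator {\<alpha>..\<beta>} z * (x k - H z * D))"

abbreviation increment :: "(real \<Rightarrow> 'a \<Rightarrow> real) \<Rightarrow> real \<Rightarrow> 'a \<Rightarrow> nat \<Rightarrow> real" where
  "increment N D \<omega> j \<equiv> N (real (Suc j) * D) \<omega> - N (real j * D) \<omega>"

text \<open>The moments are those of a centred normal variable of variance \<open>2 * D\<close>,
  with \<open>12 = 3 * 2 * 2\<close>. The notion is invariant under a change of sign of
  \<open>N\<close>, as the reflected equation requires.\<close>

definition noise :: "'a measure \<Rightarrow> (real \<Rightarrow> 'a \<Rightarrow> real) \<Rightarrow> bool" where
  "noise M N \<longleftrightarrow> prob_space M \<and> (\<forall>D>0.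
      (\<forall>n. prob_space.indep_vars M (\<lambda>_. borel) (\<lambda>j \<omega>. increment N D \<omega> j) {..<n})
    \<and> (\<forall>j. has_bochner_integral M (\<lambda>\<omega>. increment N D \<omega> j) 0
         \<and> has_bochner_integral M (\<lambda>\<omega>. (increment N D \<omega> j)\<^sup>2) (2 * D)
         \<and> has_bochner_integral M (\<lambda>\<omega>. (increment N D \<omega> j) ^ 4) (12 * D\<^sup>2)))"

lemma noise_uminus:
  assumes "noise M N"
  shows "noise M (\<lambda>t \<omega>. - N t \<omega>)"
proof -
  interpret prob_space M using assms by (simp add: noise_def)
  have eq: "- N (real (Suc j) * D) \<omega> - - N (real j * D) \<omega> = - increment N D \<omega> j" for D j \<omega> by simp
  have "indep_vars (\<lambda>_. borel) (\<lambda>j \<omega>. - increment N D \<omega> j) {..<n}" if "D > 0" for D n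
    using assms that by (intro indep_vars_compose2[where Y = "\<lambda>_ x. - x" and M' = "\<lambda>_. borel"]) (auto simp: noise_def)
  moreover have "has_bochner_integral M (\<lambda>\<omega>. - increment N D \<omega> j) 0" if "D > 0" for D j
    using has_bochner_integral_minus[of M "\<lambda>\<omega>. increment N D \<omega> j" 0] assms that by (auto simp: noise_def)
  moreover have p4: "(- x) ^ 4 = x ^ 4" for x :: real by simp
  ultimately show ?thesis
    using assms unfolding noise_def eq power2_minus p4 by (simp del: minus_diff_eq)
qed

section \<open>Gaussian moments and the increments of \<open>W 1 - W 2\<close>\<close>

lemma has_bochner_integral_normal_moment:
  assumes X: "distributed M lborel X (normal_density 0 \<sigma>)" and s: "0 < \<sigma>"
  shows "has_bochner_integral M X 0"
    "has_bochner_integral M (\<lambda>\<omega>. (X \<omega>)\<^sup>2) (\<sigma>\<^sup>2)"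
    "has_bochner_integral M (\<lambda>\<omega>. (X \<omega>) ^ 4) (3 * \<sigma> ^ 4)"
proof -
  have *: "has_bochner_integral M (\<lambda>\<omega>. (X \<omega>) ^ k) c"
    if "has_bochner_integral lborel (\<lambda>x. normal_density 0 \<sigma> x * x ^ k) c" for k c
    using that distributed_integrable[OF X, of "\<lambda>x. x ^ k"] distributed_integral[OF X, of "\<lambda>x. x ^ k"]
    by (auto simp: has_bochner_integral_iff)
  show "has_bochner_integral M X 0" using *[of 1] normal_moment_odd[OF s, of 0 0] by simp
  show "has_bochner_integral M (\<lambda>\<omega>. (X \<omega>)\<^sup>2) (\<sigma>\<^sup>2)"
    using *[of 2] normal_moment_even[OF s, of 0 1] by simp
  show "has_bochner_integral M (\<lambda>\<omega>. (X \<omega>) ^ 4) (3 * \<sigma> ^ 4)"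
  proof (rule *)
    have "fact (2 * 2) / ((2 / \<sigma>\<^sup>2) ^ 2 * fact 2) = 3 * \<sigma> ^ 4"
      using s by (simp add: fact_numeral power_divide)
    then show "has_bochner_integral lborel (\<lambda>x. normal_density 0 \<sigma> x * x ^ 4) (3 * \<sigma> ^ 4)"
      using normal_moment_even[OF s, of 0 2] by simp
  qed
qed

text \<open>Pairing the two components over each time step regroups joint independence into
  independence over steps. Within a step, the difference of two independent centred normals of
  variance \<open>D\<close> has variance \<open>2 * D\<close>.\<close>

lemma std_BM2_noise:
  assumes "std_BM2 M W"
  shows "noise M (\<lambda>t \<omega>. W 1 t \<omega> - W 2 t \<omega>)"
proof -
  interpret prob_space M using assms by (simp add: std_BM2_def)
  define \<xi> where "\<xi> D = (\<lambda>(i, j) \<omega>. W i (real (Suc j) * D) \<omega> - W i (real j * D) \<omega>)" for D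
  have BM: "indep_vars (\<lambda>_. borel) (\<xi> D) ({1,2} \<times> {..<n})"
    "\<And>i j. i \<in> {1,2} \<Longrightarrow> j < n \<Longrightarrow> distributed M lborel (\<xi> D (i, j)) (normal_density 0 (sqrt D))"
    if "D > 0" for D :: real and n
  proof -
    have grid: "real 0 * D = 0 \<and> (\<forall>j<n. real j * D < real (Suc j) * D)" using that by simp
    have "indep_vars (\<lambda>_. borel) (\<lambda>(i, j) \<omega>. W i (real (Suc j) * D) \<omega> - W i (real j * D) \<omega>) ({1,2} \<times> {..<n})
       \<and> (\<forall>i\<in>{1,2}. \<forall>j<n. distributed M lborel (\<lambda>\<omega>. W i (real (Suc j) * D) \<omega> - W i (real j * D) \<omega>)
              (\<lambda>x. ennreal (normal_density 0 (sqrt (real (Suc j) * D - real j * D)) x)))"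
      by (rule assms[unfolded std_BM2_def, THEN conjunct2, THEN conjunct2, THEN conjunct2, rule_format, OF grid])
    then show "indep_vars (\<lambda>_. borel) (\<xi> D) ({1,2} \<times> {..<n})"
      "\<And>i j. i \<in> {1,2} \<Longrightarrow> j < n \<Longrightarrow> distributed M lborel (\<xi> D (i, j)) (normal_density 0 (sqrt D))"
      by (auto simp: \<xi>_def algebra_simps)
  qed
  have inc: "increment (\<lambda>t \<omega>. W 1 t \<omega> - W 2 t \<omega>) D \<omega> j = \<xi> D (1, j) \<omega> - \<xi> D (2, j) \<omega>" for D \<omega> j
    by (simp add: \<xi>_def)
  have "indep_vars (\<lambda>_. borel) (\<lambda>j \<omega>. \<xi> D (1, j) \<omega> - \<xi> D (2, j) \<omega>) {..<n}" if D: "D > 0" for D n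
  proof -
    define K :: "nat \<Rightarrow> (nat \<times> nat) set" where "K = (\<lambda>j. {(1, j), (2, j)})"
    have "indep_vars (\<lambda>j. PiM (K j) (\<lambda>_. borel)) (\<lambda>j \<omega>. restrict (\<lambda>i. \<xi> D i \<omega>) (K j)) {..<n}"
      using BM[OF D, of n] by (intro indep_vars_restrict) (auto simp: K_def disjoint_family_on_def)
    then have "indep_vars (\<lambda>_. borel)
        (\<lambda>j \<omega>. (restrict (\<lambda>i. \<xi> D i \<omega>) (K j)) (1, j) - (restrict (\<lambda>i. \<xi> D i \<omega>) (K j)) (2, j)) {..<n}"
      by (rule indep_vars_compose2[where Y = "\<lambda>j x. x (1, j) - x (2, j)"])
        (auto intro!: borel_measurable_diff measurable_component_singleton simp: K_def)
    then show ?thesis by (simp add: K_def)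
  qed
  moreover have "has_bochner_integral M (\<lambda>\<omega>. \<xi> D (1, j) \<omega> - \<xi> D (2, j) \<omega>) 0
         \<and> has_bochner_integral M (\<lambda>\<omega>. (\<xi> D (1, j) \<omega> - \<xi> D (2, j) \<omega>)\<^sup>2) (2 * D)
         \<and> has_bochner_integral M (\<lambda>\<omega>. (\<xi> D (1, j) \<omega> - \<xi> D (2, j) \<omega>) ^ 4) (12 * D\<^sup>2)" if D: "D > 0" for D j
  proof -
    have "indep_var (PiM {(1,j)} (\<lambda>_. borel)) (\<lambda>\<omega>. restrict (\<lambda>i. \<xi> D i \<omega>) {(1,j)})
        (PiM {(2,j)} (\<lambda>_. borel)) (\<lambda>\<omega>. restrict (\<lambda>i. \<xi> D i \<omega>) {(2,j)})"
      using BM[OF D, of "Suc j"] by (intro indep_var_restrict) auto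
    then have "indep_var borel ((\<lambda>x. x (1, j)) \<circ> (\<lambda>\<omega>. restrict (\<lambda>i. \<xi> D i \<omega>) {(1,j)}))
        borel ((\<lambda>x. x (2, j)) \<circ> (\<lambda>\<omega>. restrict (\<lambda>i. \<xi> D i \<omega>) {(2,j)}))"
      by (rule indep_var_compose) (auto intro!: measurable_component_singleton)
    then have ind: "indep_var borel (\<xi> D (1, j)) borel (\<xi> D (2, j))" by (simp add: comp_def)
    have "distributed M lborel (\<lambda>\<omega>. \<xi> D (1, j) \<omega> - \<xi> D (2, j) \<omega>)
        (normal_density (0 - 0) (sqrt ((sqrt D)\<^sup>2 + (sqrt D)\<^sup>2)))"
      using D BM(2)[OF D, of _ j "Suc j"] by (intro diff_indep_normal ind) auto
    then have "distributed M lborel (\<lambda>\<omega>. \<xi> D (1, j) \<omega> - \<xi> D (2, j) \<omega>) (normal_density 0 (sqrt (2 * D)))"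
      using D by simp
    note has_bochner_integral_normal_moment[OF this]
    moreover have "sqrt (2 * D) ^ 4 = 4 * D\<^sup>2"
    proof -
      have "sqrt (2 * D) ^ 4 = ((sqrt (2 * D))\<^sup>2)\<^sup>2" by simp
      then show ?thesis using D by (simp add: power_mult_distrib del: power_mult)
    qed
    ultimately show ?thesis using D by simp
  qed
  ultimately show ?thesis
    unfolding noise_def inc using prob_space_axioms by blast
qed

section \<open>Measurability, independence and mean gain of a chain step\<close>

lemma euler_cong:
  assumes "\<And>j. j < k \<Longrightarrow> x j = x' j"
  shows "euler H \<alpha> \<beta> D y x k = euler H \<alpha> \<beta> D y x' k"
  using assms by (induction k) (auto simp: Let_def)

lemma borel_measurable_indicator_times:
  fixes H :: "real \<Rightarrow> real"
  assumes "continuous_on {\<alpha>..\<beta>} H"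
  shows "(\<lambda>z. indicator {\<alpha>..\<beta>} z * H z) \<in> borel_measurable borel"
  using borel_measurable_continuous_on_indicator[OF _ assms] by simp

lemma euler_step_measurable:
  fixes H :: "real \<Rightarrow> real"
  assumes H: "continuous_on {\<alpha>..\<beta>} H"
    and [measurable]: "f \<in> borel_measurable M" "x \<in> borel_measurable M"
  shows "(\<lambda>\<omega>. f \<omega> + indicator {\<alpha>..\<beta>} (f \<omega>) * (x \<omega> - H (f \<omega>) * D)) \<in> borel_measurable M"
proof -
  have [measurable]: "(\<lambda>z. indicator {\<alpha>..\<beta>} z * H z) \<in> borel_measurable borel"
    by (rule borel_measurable_indicator_times[OF H])
  \<comment> \<open>In this form \<open>H\<close> occurs only in the product with the indicator; it
    may fail to be measurable outside \<open>[\<alpha>, \<beta>]\<close>.\<close>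
  have "(\<lambda>\<omega>. f \<omega> + (indicator {\<alpha>..\<beta>} (f \<omega>) * x \<omega> - (indicator {\<alpha>..\<beta>} (f \<omega>) * H (f \<omega>)) * D)) \<in> borel_measurable M"
    by measurable
  then show ?thesis by (simp add: algebra_simps)
qed

lemma euler_measurable:
  assumes H: "continuous_on {\<alpha>..\<beta>} H" and x: "\<And>j. j < k \<Longrightarrow> (\<lambda>\<omega>. x \<omega> j) \<in> borel_measurable M"
  shows "(\<lambda>\<omega>. euler H \<alpha> \<beta> D y (x \<omega>) k) \<in> borel_measurable M"
  using x by (induction k) (auto simp: Let_def intro!: euler_step_measurable[OF H])

text \<open>The first \<open>k\<close> steps involve only increments with index below
  \<open>k\<close>, a block independent of \<open>\<xi> k\<close>.\<close>

lemma (in prob_space) indep_var_euler: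
  assumes ind: "indep_vars (\<lambda>_. borel) \<xi> {..<Suc k}" and H: "continuous_on {\<alpha>..\<beta>} H"
  shows "indep_var borel (\<lambda>\<omega>. euler H \<alpha> \<beta> D y (\<lambda>j. \<xi> j \<omega>) k) borel (\<xi> k)"
proof -
  have "indep_var (PiM {..<k} (\<lambda>_. borel)) (\<lambda>\<omega>. restrict (\<lambda>i. \<xi> i \<omega>) {..<k})
      (PiM {k} (\<lambda>_. borel)) (\<lambda>\<omega>. restrict (\<lambda>i. \<xi> i \<omega>) {k})"
    using ind by (intro indep_var_restrict) auto
  then have "indep_var borel ((\<lambda>x. euler H \<alpha> \<beta> D y x k) \<circ> (\<lambda>\<omega>. restrict (\<lambda>i. \<xi> i \<omega>) {..<k}))
      borel ((\<lambda>x. x k) \<circ> (\<lambda>\<omega>. restrict (\<lambda>i. \<xi> i \<omega>) {k}))"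
    by (rule indep_var_compose) (auto intro!: euler_measurable[OF H] measurable_component_singleton)
  moreover have "euler H \<alpha> \<beta> D y (restrict (\<lambda>i. \<xi> i \<omega>) {..<k}) k = euler H \<alpha> \<beta> D y (\<lambda>j. \<xi> j \<omega>) k" for \<omega>
    by (rule euler_cong) auto
  ultimately show ?thesis by (simp add: comp_def)
qed

text \<open>Independence replaces conditional expectation: the coefficients are functions of
  \<open>Z\<close>, so the linear term has mean 0 and \<open>\<xi>\<^sup>2\<close> may be replaced
  by \<open>2 * D\<close>. The equation \<open>ode\<close> then collapses the explicit terms to
  \<open>D\<close> on the event that the chain is alive. The 13 is 12 from the fourth moment plus 1
  from \<open>K * D\<^sup>2\<close>.\<close>

lemma (in prob_space) euler_step_expectation:
  fixes Z \<xi> :: "'a \<Rightarrow> real" and G u v H :: "real \<Rightarrow> real"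
  assumes ind: "indep_var borel Z borel \<xi>"
    and m1: "has_bochner_integral M \<xi> 0"
    and m2: "has_bochner_integral M (\<lambda>\<omega>. (\<xi> \<omega>)\<^sup>2) (2 * D)"
    and m4: "has_bochner_integral M (\<lambda>\<omega>. (\<xi> \<omega>) ^ 4) (12 * D\<^sup>2)"
    and u: "continuous_on {\<alpha>..\<beta>} u" and v: "continuous_on {\<alpha>..\<beta>} v" and H: "continuous_on {\<alpha>..\<beta>} H"
    and ode: "\<And>y. y \<in> {\<alpha>..\<beta>} \<Longrightarrow> v y = 1 + H y * u y"
    and G[measurable]: "G \<in> borel_measurable borel" and C: "\<And>y. \<bar>G y\<bar> \<le> C"
    and e: "0 \<le> e" and K: "0 \<le> K"
    and step: "\<And>y x. y \<in> {\<alpha>..\<beta>} \<Longrightarrow> \<bar>G (y + (x - H y * D)) - G y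
      - (- (u y * H y * D) + (u y - v y * H y * D) * x + v y / 2 * x\<^sup>2)\<bar> \<le> e * x\<^sup>2 + K * x ^ 4 + K * D\<^sup>2"
  shows "\<bar>expectation (\<lambda>\<omega>. G (Z \<omega> + indicator {\<alpha>..\<beta>} (Z \<omega>) * (\<xi> \<omega> - H (Z \<omega>) * D)))
      - expectation (\<lambda>\<omega>. G (Z \<omega>)) - D * prob {\<omega> \<in> space M. Z \<omega> \<in> {\<alpha>..\<beta>}}\<bar> \<le> 2 * e * D + 13 * K * D\<^sup>2"
proof -
  have [measurable]: "Z \<in> borel_measurable M" "\<xi> \<in> borel_measurable M"
    using ind by (auto simp: indep_var_rv1 indep_var_rv2 dest: indep_var_rv1 indep_var_rv2)
  \<comment> \<open>The coefficients vanish where the chain is frozen, so the remainder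
    \<open>R\<close> is 0 there.\<close>
  define c0 where "c0 = (\<lambda>z. indicator {\<alpha>..\<beta>} z * (- (u z * H z * D)))"
  define c1 where "c1 = (\<lambda>z. indicator {\<alpha>..\<beta>} z * (u z - v z * H z * D))"
  define c2 where "c2 = (\<lambda>z. indicator {\<alpha>..\<beta>} z * (v z / 2))"
  have c: "k \<in> borel_measurable borel \<and> integrable M (\<lambda>\<omega>. k (Z \<omega>))"
    if k: "k = (\<lambda>z. indicator {\<alpha>..\<beta>} z * l z)" and l: "continuous_on {\<alpha>..\<beta>} l" for k l :: "real \<Rightarrow> real"
  proof -
    have m[measurable]: "k \<in> borel_measurable borel" unfolding k by (rule borel_measurable_indicator_times[OF l])
    obtain B where B: "0 \<le> B" "\<And>x. x \<in> {\<alpha>..\<beta>} \<Longrightarrow> \<bar>l x\<bar> \<le> B" using continuous_on_Icc_bounded[OF l] by blast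
    have "integrable M (\<lambda>\<omega>. k (Z \<omega>))"
    proof (rule integrable_const_bound[of _ B])
      show "AE \<omega> in M. norm (k (Z \<omega>)) \<le> B" using B by (auto simp: k indicator_def)
    qed measurable
    then show ?thesis using m by blast
  qed
  have cont: "continuous_on {\<alpha>..\<beta>} (\<lambda>z. - (u z * H z * D))" "continuous_on {\<alpha>..\<beta>} (\<lambda>z. u z - v z * H z * D)"
    "continuous_on {\<alpha>..\<beta>} (\<lambda>z. v z / 2)"
    by (intro continuous_intros u v H; simp)+
  have c0: "c0 \<in> borel_measurable borel" "integrable M (\<lambda>\<omega>. c0 (Z \<omega>))"
    using c[OF c0_def cont(1)] by auto
  have c1: "c1 \<in> borel_measurable borel" "integrable M (\<lambda>\<omega>. c1 (Z \<omega>))"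
    using c[OF c1_def cont(2)] by auto
  have c2: "c2 \<in> borel_measurable borel" "integrable M (\<lambda>\<omega>. c2 (Z \<omega>))"
    using c[OF c2_def cont(3)] by auto
  note [measurable] = c0(1) c1(1) c2(1)
  have i1: "indep_var borel (\<lambda>\<omega>. c1 (Z \<omega>)) borel \<xi>"
    using indep_var_compose[OF ind c1(1), of "\<lambda>x. x" borel] by (simp add: comp_def)
  have i2: "indep_var borel (\<lambda>\<omega>. c2 (Z \<omega>)) borel (\<lambda>\<omega>. (\<xi> \<omega>)\<^sup>2)"
    using indep_var_compose[OF ind c2(1), of "\<lambda>x. x\<^sup>2" borel] by (simp add: comp_def)
  have int1: "integrable M (\<lambda>\<omega>. c1 (Z \<omega>) * \<xi> \<omega>)" "expectation (\<lambda>\<omega>. c1 (Z \<omega>) * \<xi> \<omega>) = 0"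
    using indep_var_integrable[OF i1 c1(2)] indep_var_lebesgue_integral[OF i1 c1(2)] m1
    by (auto simp: has_bochner_integral_iff)
  have int2: "integrable M (\<lambda>\<omega>. c2 (Z \<omega>) * (\<xi> \<omega>)\<^sup>2)"
      "expectation (\<lambda>\<omega>. c2 (Z \<omega>) * (\<xi> \<omega>)\<^sup>2) = expectation (\<lambda>\<omega>. c2 (Z \<omega>)) * (2 * D)"
    using indep_var_integrable[OF i2 c2(2)] indep_var_lebesgue_integral[OF i2 c2(2)] m2
    by (auto simp: has_bochner_integral_iff)
  define Z' where "Z' \<omega> = Z \<omega> + indicator {\<alpha>..\<beta>} (Z \<omega>) * (\<xi> \<omega> - H (Z \<omega>) * D)" for \<omega>
  have [measurable]: "Z' \<in> borel_measurable M"
    unfolding Z'_def[abs_def] by (intro euler_step_measurable[OF H]) auto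
  have intG: "integrable M (\<lambda>\<omega>. G (Z \<omega>))" "integrable M (\<lambda>\<omega>. G (Z' \<omega>))"
    using C by (auto intro!: integrable_const_bound[of _ C])
  define R where "R \<omega> = G (Z' \<omega>) - G (Z \<omega>) - (c0 (Z \<omega>) + c1 (Z \<omega>) * \<xi> \<omega> + c2 (Z \<omega>) * (\<xi> \<omega>)\<^sup>2)" for \<omega>
  have intR: "integrable M R" unfolding R_def[abs_def] using intG c0 int1 int2 by auto
  have mb: "has_bochner_integral M (\<lambda>\<omega>. e * (\<xi> \<omega>)\<^sup>2 + K * (\<xi> \<omega>) ^ 4 + K * D\<^sup>2) (e * (2 * D) + K * (12 * D\<^sup>2) + K * D\<^sup>2)"
    using has_bochner_integral_add[OF has_bochner_integral_add[OF has_bochner_integral_mult_right[OF m2, of e]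
      has_bochner_integral_mult_right[OF m4, of K]], of "\<lambda>_. K * D\<^sup>2" "K * D\<^sup>2"]
    by (auto simp: has_bochner_integral_iff prob_space)
  have R: "\<bar>R \<omega>\<bar> \<le> e * (\<xi> \<omega>)\<^sup>2 + K * (\<xi> \<omega>) ^ 4 + K * D\<^sup>2" for \<omega>
  proof (cases "Z \<omega> \<in> {\<alpha>..\<beta>}")
    case True
    then show ?thesis using step[OF True, of "\<xi> \<omega>"] by (simp add: R_def Z'_def c0_def c1_def c2_def)
  next
    case False
    then have "indicator {\<alpha>..\<beta>} (Z \<omega>) = (0::real)" by (rule indicator_simps(2))
    then have "R \<omega> = 0" unfolding R_def Z'_def c0_def c1_def c2_def by simp
    then show ?thesis using e K by simp
  qed
  have "\<bar>expectation R\<bar> \<le> expectation (\<lambda>\<omega>. \<bar>R \<omega>\<bar>)" by (rule integral_abs_bound)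
  also have "\<dots> \<le> expectation (\<lambda>\<omega>. e * (\<xi> \<omega>)\<^sup>2 + K * (\<xi> \<omega>) ^ 4 + K * D\<^sup>2)"
    using intR mb R by (intro integral_mono) (auto simp: has_bochner_integral_iff)
  also have "\<dots> = 2 * e * D + 13 * K * D\<^sup>2" using mb by (simp add: has_bochner_integral_iff)
  finally have ER: "\<bar>expectation R\<bar> \<le> 2 * e * D + 13 * K * D\<^sup>2" .
  have "expectation (\<lambda>\<omega>. c0 (Z \<omega>)) + expectation (\<lambda>\<omega>. c2 (Z \<omega>)) * (2 * D)
      = expectation (\<lambda>\<omega>. c0 (Z \<omega>) + c2 (Z \<omega>) * (2 * D))"
    using c0 c2 by simp
  also have "\<dots> = expectation (\<lambda>\<omega>. D * indicator {\<omega> \<in> space M. Z \<omega> \<in> {\<alpha>..\<beta>}} \<omega>)"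
    by (intro Bochner_Integration.integral_cong) (auto simp: c0_def c2_def indicator_def ode algebra_simps)
  also have "\<dots> = D * prob {\<omega> \<in> space M. Z \<omega> \<in> {\<alpha>..\<beta>}}" by simp
  finally have gen: "expectation (\<lambda>\<omega>. c0 (Z \<omega>)) + expectation (\<lambda>\<omega>. c2 (Z \<omega>)) * (2 * D)
      = D * prob {\<omega> \<in> space M. Z \<omega> \<in> {\<alpha>..\<beta>}}" .
  have "expectation R = expectation (\<lambda>\<omega>. G (Z' \<omega>)) - expectation (\<lambda>\<omega>. G (Z \<omega>))
      - (expectation (\<lambda>\<omega>. c0 (Z \<omega>)) + 0 + expectation (\<lambda>\<omega>. c2 (Z \<omega>)) * (2 * D))"
    unfolding R_def[abs_def] int1(2)[symmetric] int2(2)[symmetric] using intG c0 int1(1) int2(1) by simp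
  then show ?thesis using ER gen by (simp add: Z'_def)
qed

text \<open>A discrete Dynkin formula: since \<open>f'' - H f' = 1\<close>, the stopped chain gains on average the time it spends alive.\<close>
lemma euler_expectation_limit:
  fixes f u v H :: "real \<Rightarrow> real" and y0 :: real
  assumes noise: "noise M N"
    and f: "\<And>y. y \<in> {a..b} \<Longrightarrow> (f has_real_derivative u y) (at y)"
    and u: "\<And>y. y \<in> {a..b} \<Longrightarrow> (u has_real_derivative v y) (at y)"
    and v: "continuous_on {a..b} v" and H: "continuous_on {\<alpha>..\<beta>} H"
    and ode: "\<And>y. y \<in> {\<alpha>..\<beta>} \<Longrightarrow> v y = 1 + H y * u y"
    and ab: "a < \<alpha>" "\<alpha> \<le> \<beta>" "\<beta> < b" and T: "0 < T"
  defines "Z \<equiv> \<lambda>n \<omega> k. euler H \<alpha> \<beta> (T / real n) y0 (increment N (T / real n) \<omega>) k"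
  shows "(\<lambda>n. (\<integral>\<omega>. clamped f a b (Z n \<omega> n) \<partial>M)
      - (\<Sum>k<n. T / real n * measure M {\<omega> \<in> space M. Z n \<omega> k \<in> {\<alpha>..\<beta>}})) \<longlonglongrightarrow> clamped f a b y0"
proof (rule LIMSEQ_I)
  fix r :: real assume r: "0 < r"
  interpret prob_space M using noise by (simp add: noise_def)
  \<comment> \<open>Summed over all steps, the \<open>e\<close> terms give
    \<open>2 * e * T = r / 4\<close>; \<open>n0\<close> leaves less than \<open>r / 2\<close> for
    the terms of order \<open>D\<^sup>2\<close> and also forces \<open>D \<le> 1\<close>.\<close>
  define e where "e = r / (8 * T)"
  have e: "0 < e" using r T by (simp add: e_def)
  obtain K where K: "0 \<le> K" and step: "\<And>y x D. y \<in> {\<alpha>..\<beta>} \<Longrightarrow> D \<in> {0..1} \<Longrightarrow>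
    \<bar>clamped f a b (y + (x - H y * D)) - clamped f a b y
      - (- (u y * H y * D) + (u y - v y * H y * D) * x + v y / 2 * x\<^sup>2)\<bar> \<le> e * x\<^sup>2 + K * x ^ 4 + K * D\<^sup>2"
    using euler_step_expansion[OF f u v H ab e] by auto
  have cf: "continuous_on {a..b} f" and cu: "continuous_on {a..b} u"
    using f u by (blast intro: continuous_at_imp_continuous_on DERIV_isCont)+
  have sub: "{\<alpha>..\<beta>} \<subseteq> {a..b}" using ab by auto
  obtain C where C: "\<And>y. y \<in> {a..b} \<Longrightarrow> \<bar>f y\<bar> \<le> C" using continuous_on_Icc_bounded[OF cf] by blast
  have GC: "\<bar>clamped f a b y\<bar> \<le> C" for y using ab by (intro C) auto
  have "continuous_on UNIV (clamped f a b)"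
    using ab by (intro continuous_on_compose2[OF cf] continuous_intros) auto
  then have Gm: "clamped f a b \<in> borel_measurable borel" by (rule borel_measurable_continuous_onI)
  define n0 where "n0 = nat \<lceil>max T (26 * K * T\<^sup>2 / r)\<rceil> + 1"
  show "\<exists>no. \<forall>n\<ge>no. norm ((\<integral>\<omega>. clamped f a b (Z n \<omega> n) \<partial>M)
      - (\<Sum>k<n. T / real n * measure M {\<omega> \<in> space M. Z n \<omega> k \<in> {\<alpha>..\<beta>}}) - clamped f a b y0) < r"
  proof (intro exI[of _ n0] allI impI)
    fix n assume "n0 \<le> n"
    then have "real n \<ge> real n0" by simp
    then have n: "real n > T" "real n > 26 * K * T\<^sup>2 / r" unfolding n0_def by linarith+
    define D where "D = T / real n"
    have D: "0 < D" "D \<le> 1" using T n by (auto simp: D_def)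
    have nD: "real n * D = T" using n T by (simp add: D_def)
    define A where "A k = measure M {\<omega> \<in> space M. Z n \<omega> k \<in> {\<alpha>..\<beta>}}" for k
    define E where "E k = (\<integral>\<omega>. clamped f a b (Z n \<omega> k) \<partial>M)" for k
    have ind: "indep_vars (\<lambda>_. borel) (\<lambda>j \<omega>. increment N D \<omega> j) {..<Suc k}" for k
      using noise D by (auto simp: noise_def)
    have one: "\<bar>E (Suc k) - E k - D * A k\<bar> \<le> 2 * e * D + 13 * K * D\<^sup>2" for k
    proof -
      have Zs: "Z n \<omega> (Suc k) = Z n \<omega> k + indicator {\<alpha>..\<beta>} (Z n \<omega> k) * (increment N D \<omega> k - H (Z n \<omega> k) * D)" for \<omega>
        by (simp add: Z_def D_def Let_def)
      show ?thesis unfolding E_def A_def Zs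
      proof (rule euler_step_expectation[where u = u and v = v and C = C])
        show "indep_var borel (\<lambda>\<omega>. Z n \<omega> k) borel (\<lambda>\<omega>. increment N D \<omega> k)"
          unfolding Z_def D_def[symmetric] by (rule indep_var_euler[OF ind H])
        show "continuous_on {\<alpha>..\<beta>} u" "continuous_on {\<alpha>..\<beta>} v"
          using continuous_on_subset[OF cu sub] continuous_on_subset[OF v sub] by auto
      qed (use noise D H ode Gm GC e K step in \<open>auto simp: noise_def\<close>)
    qed
    have tele: "\<bar>E k - (\<Sum>j<k. D * A j) - E 0\<bar> \<le> real k * (2 * e * D + 13 * K * D\<^sup>2)" for k
    proof (induction k)
      case (Suc k)
      have "real (Suc k) * (2 * e * D + 13 * K * D\<^sup>2) = real k * (2 * e * D + 13 * K * D\<^sup>2) + (2 * e * D + 13 * K * D\<^sup>2)"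
        by (simp add: algebra_simps)
      then show ?case using Suc one[of k] by simp
    qed simp
    have "real n * (2 * e * D + 13 * K * D\<^sup>2) = 2 * e * (real n * D) + 13 * K * (real n * D) * D"
      by (simp add: power2_eq_square algebra_simps)
    also have "\<dots> = 2 * e * T + 13 * K * T * D" unfolding nD ..
    also have "\<dots> < r"
    proof -
      have "26 * K * T\<^sup>2 < real n * r" using n r by (simp add: field_simps)
      then have "13 * K * T * D < r / 2" using n T by (simp add: D_def field_simps power2_eq_square)
      moreover have "2 * e * T = r / 4" using T by (simp add: e_def)
      ultimately show ?thesis using r by linarith
    qed
    finally have "\<bar>E n - (\<Sum>j<n. D * A j) - E 0\<bar> < r" using tele[of n] by linarith
    moreover have "E 0 = clamped f a b y0" by (simp add: E_def Z_def prob_space)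
    ultimately show "norm ((\<integral>\<omega>. clamped f a b (Z n \<omega> n) \<partial>M)
      - (\<Sum>k<n. T / real n * measure M {\<omega> \<in> space M. Z n \<omega> k \<in> {\<alpha>..\<beta>}}) - clamped f a b y0) < r"
      by (simp add: E_def A_def D_def)
  qed
qed

section \<open>Pathwise comparison\<close>

text \<open>Beyond the last time \<open>s\<close> with \<open>E s \<le> 0\<close> the function is
  positive, so \<open>E s = 0\<close> if \<open>s < b\<close>; but \<open>E\<close> decreases just
  after such a zero. The derivative is prescribed at zeros only, since in the comparison its sign is
  known only where the two paths meet.\<close>

lemma nonpos_if_decreasing_at_zeros:
  fixes E :: "real \<Rightarrow> real"
  assumes "a \<le> b" and cont: "continuous_on {a..b} E" and "E a \<le> 0"
    and dec: "\<And>t. a \<le> t \<Longrightarrow> t < b \<Longrightarrow> E t = 0 \<Longrightarrow> \<exists>l<0. (E has_real_derivative l) (at t within {a..b})"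
  shows "E b \<le> 0"
proof (rule ccontr)
  assume b: "\<not> E b \<le> 0"
  define S where "S = {t \<in> {a..b}. E t \<le> 0}"
  have S: "closed S" unfolding S_def by (intro continuous_on_closed_Collect_le cont continuous_intros)
  have "a \<in> S" using assms by (auto simp: S_def)
  have bd: "bdd_above S" by (auto simp: S_def bdd_above_def)
  define s where "s = Sup S"
  have "s \<in> S" unfolding s_def using S bd \<open>a \<in> S\<close> by (intro closed_contains_Sup) auto
  then have s: "a \<le> s" "s \<le> b" "E s \<le> 0" by (auto simp: S_def)
  have after: "0 < E t" if "s < t" "t \<le> b" for t
  proof (rule ccontr)
    assume "\<not> 0 < E t"
    then have "t \<in> S" using that s by (auto simp: S_def)
    then have "t \<le> s" unfolding s_def using bd by (rule cSup_upper)
    then show False using that by simp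
  qed
  have sb: "s < b" using s b by (cases "s = b") auto
  have "\<exists>x\<ge>s. x \<le> b \<and> E x = 0"
    using s b by (intro IVT' continuous_on_subset[OF cont]) auto
  then have "E s = 0" using after by (metis less_eq_real_def less_irrefl)
  then obtain l where l: "l < 0" "(E has_real_derivative l) (at s within {a..b})" using dec s sb by blast
  from has_real_derivative_neg_dec_right[OF l(2,1)] obtain d where
    d: "d > 0" "\<And>k. 0 < k \<Longrightarrow> s + k \<in> {a..b} \<Longrightarrow> k < d \<Longrightarrow> E (s + k) < E s" by blast
  define k where "k = min (d / 2) (b - s)"
  have "0 < k" "s + k \<in> {a..b}" "k < d" using d(1) sb s by (auto simp: k_def)
  then have "E (s + k) < 0" "0 < E (s + k)" using d(2) \<open>E s = 0\<close> after by force+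
  then show False by simp
qed

text \<open>The margin \<open>\<epsilon>\<close> in the drift absorbs the discretization error, so only continuity of \<open>h\<close> is needed:
  at a contact time the solution falls away from the interpolated chain.\<close>
lemma euler_comparison:
  fixes Y N h :: "real \<Rightarrow> real" and \<tau> :: ereal
  assumes N: "continuous_on {0..} N" and N0: "N 0 = 0"
    and h: "continuous_on {-L<..<L} h"
    and Y: "continuous_on {t. 0 \<le> t \<and> ereal t < \<tau>} Y"
    and Yin: "\<And>t. 0 \<le> t \<Longrightarrow> ereal t < \<tau> \<Longrightarrow> Y t \<in> {-L<..<L}"
    and eqn: "\<And>t. 0 \<le> t \<Longrightarrow> ereal t < \<tau> \<Longrightarrow> Y t = y0 - integral {0..t} (\<lambda>s. h (Y s)) + N t"
    and \<rho>: "0 < \<rho>" "-L < \<alpha> - \<rho>" "\<beta> + \<rho> < L" and y0: "y0 \<le> \<beta>" and \<epsilon>: "0 < \<epsilon>" and T: "0 < T"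
  defines "Z \<equiv> \<lambda>n k. euler (\<lambda>y. h y - \<epsilon>) \<alpha> \<beta> (T / real n) y0
      (\<lambda>j. N (real (Suc j) * (T / real n)) - N (real j * (T / real n))) k"
  shows "\<exists>n0. \<forall>n\<ge>n0. \<forall>k\<le>n. (\<forall>j<k. Z n j \<in> {\<alpha>..\<beta>}) \<longrightarrow>
    (ereal (real k * (T / real n)) < \<tau> \<longrightarrow> Y (real k * (T / real n)) \<le> Z n k) \<and>
    (\<forall>t. 0 \<le> t \<and> t \<le> real k * (T / real n) \<and> ereal t < \<tau> \<longrightarrow> Y t \<le> \<beta> + \<rho>)"
proof -
  have "uniformly_continuous_on {\<alpha> - \<rho>..\<beta> + \<rho>} h"
    using \<rho> by (intro compact_uniformly_continuous continuous_on_subset[OF h]) auto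
  then obtain \<kappa>0 where \<kappa>0: "0 < \<kappa>0" "\<And>x y. x \<in> {\<alpha> - \<rho>..\<beta> + \<rho>} \<Longrightarrow> y \<in> {\<alpha> - \<rho>..\<beta> + \<rho>} \<Longrightarrow>
      dist y x < \<kappa>0 \<Longrightarrow> dist (h y) (h x) < \<epsilon>"
    using \<epsilon> unfolding uniformly_continuous_on_def by metis
  \<comment> \<open>Within one step the interpolated chain moves by at most \<open>\<kappa>\<close>
    through the noise and \<open>\<kappa>\<close> through the drift. A shift of
    \<open>2 * \<kappa>\<close> changes \<open>h\<close> by less than \<open>\<epsilon>\<close> and
    stays within the margin \<open>\<rho>\<close>.\<close>
  define \<kappa> where "\<kappa> = min \<kappa>0 \<rho> / 3"
  have \<kappa>: "0 < \<kappa>" "2 * \<kappa> < \<kappa>0" "2 * \<kappa> \<le> \<rho>" using \<kappa>0 \<rho> by (auto simp: \<kappa>_def)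
  have "uniformly_continuous_on {0..T} N"
    by (intro compact_uniformly_continuous continuous_on_subset[OF N]) auto
  then obtain d where d: "0 < d" "\<And>x y. x \<in> {0..T} \<Longrightarrow> y \<in> {0..T} \<Longrightarrow> dist y x < d \<Longrightarrow> dist (N y) (N x) < \<kappa>"
    using \<kappa> unfolding uniformly_continuous_on_def by metis
  have "continuous_on {\<alpha>..\<beta>} (\<lambda>y. h y - \<epsilon>)"
    using \<rho> by (intro continuous_intros continuous_on_subset[OF h]) auto
  from continuous_on_Icc_bounded[OF this] obtain B where
    B: "0 \<le> B" "\<And>y. y \<in> {\<alpha>..\<beta>} \<Longrightarrow> \<bar>h y - \<epsilon>\<bar> \<le> B" by blast
  define n0 where "n0 = nat \<lceil>max (T / d) (B * T / \<kappa>)\<rceil> + 1"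
  have main: "(ereal (real k * (T / real n)) < \<tau> \<longrightarrow> Y (real k * (T / real n)) \<le> Z n k) \<and>
      (\<forall>t. 0 \<le> t \<and> t \<le> real k * (T / real n) \<and> ereal t < \<tau> \<longrightarrow> Y t \<le> \<beta> + \<rho>)"
    if n: "n0 \<le> n" and k: "k \<le> n" "\<forall>j<k. Z n j \<in> {\<alpha>..\<beta>}" for n k
    using k
  proof (induction k)
    case 0
    have Y0: "Y 0 = y0" if "ereal 0 < \<tau>" using eqn[of 0] that N0 by simp
    have le: "Y t \<le> \<beta> + \<rho>" if "0 \<le> t" "t \<le> 0" "ereal t < \<tau>" for t
    proof -
      have "t = 0" using that by simp
      then show ?thesis using Y0 that y0 \<rho>(1) by simp
    qed
    show ?case
    proof (intro conjI allI impI)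
      show "Y (real 0 * (T / real n)) \<le> Z n 0" if "ereal (real 0 * (T / real n)) < \<tau>"
        using Y0 that by (simp add: Z_def)
      show "Y t \<le> \<beta> + \<rho>" if "0 \<le> t \<and> t \<le> real 0 * (T / real n) \<and> ereal t < \<tau>" for t
        using le[of t] that by simp
    qed
  next
    case (Suc k)
    define D where "D = T / real n"
    have "real n \<ge> real n0" using n by simp
    then have n': "real n > T / d" "real n > B * T / \<kappa>" "0 < real n" unfolding n0_def by linarith+
    have D: "0 < D" "D < d" "B * D \<le> \<kappa>" "real n * D = T"
      using n' T d(1) \<kappa>(1) by (auto simp: D_def field_simps)
    define a where "a = real k * D"
    have a0: "0 \<le> a" using D by (simp add: a_def)
    have aD: "real (Suc k) * D = a + D" by (simp add: a_def algebra_simps)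
    have "real (Suc k) * D \<le> real n * D" using Suc.prems D by (intro mult_right_mono) auto
    then have aT: "a + D \<le> T" using aD D by simp
    have Zk: "Z n k \<in> {\<alpha>..\<beta>}" using Suc.prems by simp
    have IH1: "ereal a < \<tau> \<Longrightarrow> Y a \<le> Z n k"
      and IH2: "\<And>t. 0 \<le> t \<Longrightarrow> t \<le> a \<Longrightarrow> ereal t < \<tau> \<Longrightarrow> Y t \<le> \<beta> + \<rho>"
      using Suc unfolding a_def D_def by auto
    define H where "H = h (Z n k) - \<epsilon>"
    \<comment> \<open>The drift is frozen at the left grid point but the noise is the true path, so
      the noise cancels in \<open>Y t - z t\<close>.\<close>
    define z where "z t = Z n k - H * (t - a) + (N t - N a)" for t
    have zZ: "\<bar>z t - Z n k\<bar> \<le> 2 * \<kappa>" if t: "a \<le> t" "t \<le> a + D" for t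
    proof -
      have "dist (N t) (N a) < \<kappa>" using t a0 aT D by (intro d(2)) (auto simp: dist_real_def)
      moreover have "\<bar>H * (t - a)\<bar> \<le> B * D"
        unfolding abs_mult H_def using t B Zk by (intro mult_mono) auto
      ultimately show ?thesis using D by (auto simp: z_def dist_real_def)
    qed
    have le: "Y t2 \<le> z t2" if t2: "a \<le> t2" "t2 \<le> a + D" "ereal t2 < \<tau>" for t2
    proof -
      have sub: "ereal t < \<tau>" if "t \<le> t2" for t
        using that t2(3) by (meson ereal_less_eq(3) le_less_trans)
      have hY: "continuous_on {0..t2} (\<lambda>s. h (Y s))"
        using Yin sub by (intro continuous_on_compose2[OF h continuous_on_subset[OF Y]]) auto
      \<comment> \<open>This is \<open>Y - z\<close> with the noise cancelled: differentiable,
        although neither path need be.\<close>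
      define E where "E t = y0 + N a - Z n k - integral {0..t} (\<lambda>s. h (Y s)) + H * (t - a)" for t
      have E: "Y t - z t = E t" if "a \<le> t" "t \<le> t2" for t
        using eqn[of t] that a0 sub by (simp add: E_def z_def)
      have dE: "(E has_real_derivative (- h (Y t) + H)) (at t within {a..t2})" if "a \<le> t" "t \<le> t2" for t
      proof -
        have "((\<lambda>t. integral {0..t} (\<lambda>s. h (Y s))) has_real_derivative h (Y t)) (at t within {a..t2})"
          using that a0 by (intro DERIV_subset[OF integral_has_real_derivative[OF hY]]) auto
        then show ?thesis unfolding E_def[abs_def] by (auto intro!: derivative_eq_intros)
      qed
      have "E t2 \<le> 0"
      proof (rule nonpos_if_decreasing_at_zeros[where E = E and a = a and b = t2])
        show "a \<le> t2" by fact
        show "continuous_on {a..t2} E" by (rule DERIV_continuous_on[OF dE]) auto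
        show "E a \<le> 0" using E[of a] IH1 t2 sub[of a] by (simp add: z_def)
        fix t assume t: "a \<le> t" "t < t2" "E t = 0"
        then have Yz: "Y t = z t" using E[of t] by simp
        have zt: "\<bar>z t - Z n k\<bar> \<le> 2 * \<kappa>" using t t2 by (intro zZ) auto
        have "dist (h (z t)) (h (Z n k)) < \<epsilon>"
        proof (rule \<kappa>0(2))
          show "Z n k \<in> {\<alpha> - \<rho>..\<beta> + \<rho>}" "z t \<in> {\<alpha> - \<rho>..\<beta> + \<rho>}" "dist (z t) (Z n k) < \<kappa>0"
            using Zk \<rho> \<kappa> zt unfolding atLeastAtMost_iff dist_real_def by linarith+
        qed
        then have "- h (Y t) + H < 0" by (simp add: Yz H_def dist_real_def)
        then show "\<exists>l<0. (E has_real_derivative l) (at t within {a..t2})"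
          using dE[of t] t by (intro exI[of _ "- h (Y t) + H"]) auto
      qed
      then show ?thesis using E[of t2] t2 by simp
    qed
    \<comment> \<open>Only \<open>Z n k\<close> has to lie in the interval;
      \<open>Z n (Suc k)\<close> may already be outside, so the comparison includes the step of
      exit.\<close>
    have "Z n (Suc k) = z (a + D)"
      using Zk aD unfolding Z_def z_def H_def D_def[symmetric] by (simp add: Let_def a_def Z_def algebra_simps)
    then have "ereal (a + D) < \<tau> \<Longrightarrow> Y (a + D) \<le> Z n (Suc k)" using le[of "a + D"] D by simp
    moreover have "Y t \<le> \<beta> + \<rho>" if t: "0 \<le> t" "t \<le> a + D" "ereal t < \<tau>" for t
    proof (cases "t \<le> a")
      case False
      then have "Y t \<le> z t" "\<bar>z t - Z n k\<bar> \<le> 2 * \<kappa>" using le zZ t by auto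
      then show ?thesis using \<kappa> Zk unfolding atLeastAtMost_iff by linarith
    qed (use IH2 t in auto)
    ultimately show ?case unfolding D_def[symmetric] aD by blast
  qed
  show ?thesis by (intro exI[of _ n0] allI impI) (rule main)
qed

section \<open>Scale function\<close>

lemma antiderivative_open_interval:
  fixes f :: "real \<Rightarrow> real"
  assumes "a < c" "c < b" and f: "continuous_on {a<..<b} f"
  shows "\<exists>F. F c = 0 \<and> (\<forall>x\<in>{a<..<b}. (F has_real_derivative f x) (at x))"
proof -
  have "\<exists>F. \<forall>x. ereal a < ereal x \<longrightarrow> ereal x < ereal b \<longrightarrow> (F has_vector_derivative f x) (at x)"
    using assms by (intro einterval_antiderivative) (auto simp: continuous_on_eq_continuous_at)
  then obtain F where F: "\<And>x. x \<in> {a<..<b} \<Longrightarrow> (F has_real_derivative f x) (at x)"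
    by (auto simp: has_real_derivative_iff_has_vector_derivative)
  then have "\<forall>x\<in>{a<..<b}. ((\<lambda>x. F x - F c) has_real_derivative f x) (at x)"
    by (auto intro!: derivative_eq_intros)
  then show ?thesis by (intro exI[of _ "\<lambda>x. F x - F c"]) auto
qed

section \<open>The logistic coordinate\<close>

text \<open>The first market weight as a function of the log-ratio: \<open>mu X 1\<close> is
  \<open>logistic Y\<close> and \<open>mu X 2\<close> is \<open>logistic (- Y)\<close>. The interval
  \<open>(-L, L)\<close> corresponds to \<open>(\<delta>, 1 - \<delta>)\<close>.\<close>

definition logistic :: "real \<Rightarrow> real" where
  "logistic y = 1 / (1 + exp (- y))"

lemma logistic_pos: "0 < logistic y" and logistic_less_1: "logistic y < 1"
  by (auto simp: logistic_def add_pos_pos field_simps)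

lemma logistic_0: "logistic 0 = 1 / 2"
  by (simp add: logistic_def)

lemma logistic_minus: "logistic (- y) = 1 - logistic y"
proof -
  have "0 < 1 + exp y" "0 < 1 + exp (- y)" by (auto intro: add_pos_pos)
  then show ?thesis by (simp add: logistic_def field_simps flip: exp_add)
qed

lemma logistic_less_iff: "logistic x < logistic y \<longleftrightarrow> x < y"
proof -
  have "0 < 1 + exp (- x)" "0 < 1 + exp (- y)" by (auto intro: add_pos_pos)
  then show ?thesis by (simp add: logistic_def field_simps)
qed

lemma logistic_le_iff: "logistic x \<le> logistic y \<longleftrightarrow> x \<le> y"
  using logistic_less_iff[of y x] by linarith

lemma logistic_logit:
  assumes "0 < m" "m < 1"
  shows "logistic (ln (m / (1 - m))) = m"
proof -
  have "exp (- ln (m / (1 - m))) = (1 - m) / m" using assms by (simp add: exp_minus)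
  then show ?thesis unfolding logistic_def using assms by (simp only:) (simp add: field_simps)
qed

lemma DERIV_logistic: "(logistic has_real_derivative logistic y * (1 - logistic y)) (at y)"
proof -
  have p: "0 < 1 + exp (- y)" by (auto intro: add_pos_pos)
  then have "(logistic has_real_derivative exp (- y) / (1 + exp (- y))\<^sup>2) (at y)"
    unfolding logistic_def[abs_def] by (auto intro!: derivative_eq_intros simp: power2_eq_square)
  also have "exp (- y) / (1 + exp (- y))\<^sup>2 = logistic y * (1 - logistic y)"
    using p by (simp add: logistic_def field_simps power2_eq_square)
  finally show ?thesis .
qed

lemma A2_pos: "0 < m \<Longrightarrow> m < 1 \<Longrightarrow> 0 < A2 m"
  by (simp add: A2_def)

text \<open>\<open>A2\<close> is the reciprocal of the derivative of \<open>logistic\<close>, so the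
  substitution \<open>m = logistic y\<close> turns \<open>A2 m * g m dm\<close> into
  \<open>g (logistic y) dy\<close>.\<close>

lemma A2_logistic: "A2 (logistic y) * (logistic y * (1 - logistic y)) = 1"
  using logistic_pos[of y] logistic_less_1[of y] by (simp add: A2_def)

text \<open>Up to sign, the drift of \<open>ln X 1 - ln X 2\<close>, with both weights written in
  the log-ratio \<open>y\<close>.\<close>

definition logit_drift :: "(real \<Rightarrow> real) \<Rightarrow> real \<Rightarrow> real" where
  "logit_drift g y = g (logistic y) - g (logistic (- y))"

lemma logit_drift_minus: "logit_drift g (- y) = - logit_drift g y"
  by (simp add: logit_drift_def)

text \<open>The fundamental theorem of calculus on \<open>[c, m]\<close> and monotone exhaustion of
  \<open>[c, e)\<close>: the integral is the supremum of the values \<open>R m\<close>, finite or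
  not.\<close>

lemma nn_integral_exp_eq_top_iff:
  fixes Q R :: "real \<Rightarrow> real"
  assumes c: "c < e" and R: "\<And>m. m \<in> {c..<e} \<Longrightarrow> (R has_real_derivative exp (Q m)) (at m)"
    and Q: "continuous_on {c..<e} Q" and R0: "R c = 0"
  shows "(\<integral>\<^sup>+ y. ennreal (exp (Q y)) * indicator {c..<e} y \<partial>lborel) = \<infinity> \<longleftrightarrow> (\<forall>K. \<exists>m\<in>{c..<e}. K \<le> R m)"
proof -
  define f where "f = (\<lambda>y. indicator {c..<e} y * exp (Q y))"
  have f[measurable]: "f \<in> borel_measurable borel"
    using borel_measurable_continuous_on_indicator[of "{c..<e}" "\<lambda>y. exp (Q y)"] Q
    by (auto simp: f_def intro!: continuous_intros)
  have FTC: "(\<integral>\<^sup>+ y. ennreal (f y) * indicator {c..m} y \<partial>lborel) = ennreal (R m)" if "m \<in> {c..<e}" for m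
  proof -
    have "(\<integral>\<^sup>+ y. ennreal (f y) * indicator {c..m} y \<partial>lborel) = R m - R c"
    proof (rule nn_integral_FTC_Icc[OF f])
      fix x assume x: "x \<in> {c..m}"
      then show "(R has_real_derivative f x) (at x)"
        using that R[of x] by (auto simp: f_def)
      show "0 \<le> f x" by (simp add: f_def)
    qed (use that in auto)
    then show ?thesis by (simp add: R0)
  qed
  define D where "D = density lborel (\<lambda>y. ennreal (f y))"
  define A where "A n = {c..e - (e - c) / real (Suc n)}" for n
  have An: "e - (e - c) / real (Suc n) \<in> {c..<e}" for n
  proof -
    have "(e - c) / real (Suc n) \<le> e - c"
      using c divide_left_mono[of 1 "real (Suc n)" "e - c"] by simp
    then show ?thesis using c by simp
  qed
  have DA: "emeasure D {c..m} = ennreal (R m)" if "m \<in> {c..<e}" for m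
    using FTC[OF that] by (simp add: D_def emeasure_density)
  have inc: "incseq A"
  proof (rule incseq_SucI)
    fix n
    have "(e - c) / real (Suc (Suc n)) \<le> (e - c) / real (Suc n)"
      using c by (intro divide_left_mono) auto
    then show "A n \<le> A (Suc n)" by (auto simp: A_def)
  qed
  have "(SUP n. emeasure D (A n)) = emeasure D (\<Union>n. A n)"
    by (rule SUP_emeasure_incseq[OF _ inc]) (auto simp: A_def D_def)
  moreover have UA: "(\<Union>n. A n) = {c..<e}"
  proof (intro equalityI subsetI)
    fix x assume x: "x \<in> {c..<e}"
    obtain n where "(e - c) / (e - x) < real n" using reals_Archimedean2 by blast
    then have "(e - c) / real (Suc n) \<le> e - x" using x by (auto simp: field_simps)
    then show "x \<in> (\<Union>n. A n)" using x by (auto simp: A_def intro!: exI[of _ n])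
  next
    fix x assume "x \<in> (\<Union>n. A n)"
    then obtain n where "x \<in> A n" by blast
    with An[of n] show "x \<in> {c..<e}" by (auto simp: A_def)
  qed
  moreover have ED: "emeasure D {c..<e} = (\<integral>\<^sup>+ y. ennreal (exp (Q y)) * indicator {c..<e} y \<partial>lborel)"
  proof -
    have "emeasure D {c..<e} = (\<integral>\<^sup>+ y. ennreal (f y) * indicator {c..<e} y \<partial>lborel)"
      unfolding D_def by (intro emeasure_density) auto
    also have "\<dots> = (\<integral>\<^sup>+ y. ennreal (exp (Q y)) * indicator {c..<e} y \<partial>lborel)"
      by (intro nn_integral_cong) (simp add: f_def indicator_def)
    finally show ?thesis .
  qed
  ultimately have I: "(\<integral>\<^sup>+ y. ennreal (exp (Q y)) * indicator {c..<e} y \<partial>lborel)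
      = (SUP n. ennreal (R (e - (e - c) / real (Suc n))))"
    using DA[OF An] by (simp add: A_def)
  show ?thesis
  proof
    assume inf: "(\<integral>\<^sup>+ y. ennreal (exp (Q y)) * indicator {c..<e} y \<partial>lborel) = \<infinity>"
    show "\<forall>K. \<exists>m\<in>{c..<e}. K \<le> R m"
    proof (rule ccontr)
      assume "\<not> (\<forall>K. \<exists>m\<in>{c..<e}. K \<le> R m)"
      then obtain K where "\<forall>m\<in>{c..<e}. R m < K" by (auto simp: not_le)
      then have "(SUP n. ennreal (R (e - (e - c) / real (Suc n)))) \<le> ennreal K"
        using An by (intro SUP_least ennreal_leI) (meson less_imp_le)
      then have "\<infinity> \<le> ennreal K" unfolding I[symmetric] inf .
      then show False by (simp add: top_unique)
    qed
  next
    assume unb: "\<forall>K. \<exists>m\<in>{c..<e}. K \<le> R m"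
    show "(\<integral>\<^sup>+ y. ennreal (exp (Q y)) * indicator {c..<e} y \<partial>lborel) = \<infinity>"
    proof (rule ccontr)
      assume "(\<integral>\<^sup>+ y. ennreal (exp (Q y)) * indicator {c..<e} y \<partial>lborel) \<noteq> \<infinity>"
      then have fin: "emeasure D {c..<e} < \<top>"
        using ED by (simp add: less_top)
      then obtain K where K: "emeasure D {c..<e} = ennreal K" "0 \<le> K"
        by (metis ennreal_cases less_irrefl infinity_ennreal_def)
      obtain m where m: "m \<in> {c..<e}" "K + 1 \<le> R m" using unb by blast
      have "ennreal (K + 1) \<le> ennreal (R m)" using m by (intro ennreal_leI)
      also have "\<dots> = emeasure D {c..m}" using DA m by simp
      also have "\<dots> \<le> emeasure D {c..<e}" using m by (intro emeasure_mono) (auto simp: D_def)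
      finally show False using K by simp
    qed
  qed
qed

text \<open>\<open>exp p\<close> is the scale density for the drift \<open>h - 1\<close>, and
  \<open>S\<close> is the integral of the theorem in the logit coordinate. They are comparable for
  both signs of \<open>y\<close> because only the \<open>Q\<close> term of the larger weight can be
  unbounded in \<open>p\<close>: the other is evaluated in \<open>[\<delta>, 1/2]\<close>, where
  \<open>Q\<close> is bounded, and \<open>\<bar>y\<bar> < L\<close>.\<close>

lemma scale_function:
  fixes g :: "real \<Rightarrow> real"
  assumes \<delta>: "0 < \<delta>" "\<delta> < 1 / 2" and g: "admissible \<delta> g"
  defines "L \<equiv> ln ((1 - \<delta>) / \<delta>)"
  shows "\<exists>p S s B. 0 < B
    \<and> (\<forall>y\<in>{-L<..<L}. (p has_real_derivative logit_drift g y - 1) (at y))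
    \<and> (\<forall>y\<in>{0..<L}. (S has_real_derivative s y) (at y))
    \<and> (\<forall>y\<in>{-L<..<L}. s \<bar>y\<bar> \<le> B * exp (p y) \<and> exp (p y) \<le> B * s \<bar>y\<bar> \<and> exp (- p y) \<le> B)
    \<and> ((\<integral>\<^sup>+ y. ennreal (exp (integral {1/2..y} (\<lambda>z. A2 z * g z))) * indicator {1/2..<1 - \<delta>} y \<partial>lborel) = \<infinity>
        \<longleftrightarrow> (\<forall>K. \<exists>y\<in>{0..<L}. K \<le> S y))"
proof -
  have gc: "continuous_on {0<..<1 - \<delta>} g" and gl: "filterlim g at_top (at_left (1 - \<delta>))"
    using g by (auto simp: admissible_def)
  have "continuous_on {0<..<1 - \<delta>} A2"
    unfolding A2_def[abs_def] using \<delta> by (intro continuous_intros) auto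
  then have "continuous_on {0<..<1 - \<delta>} (\<lambda>m. A2 m * g m)" using gc by (intro continuous_intros)
  from antiderivative_open_interval[OF _ _ this, of "1/2"] \<delta> obtain Q where
    Q0: "Q (1/2) = 0" and Q: "\<And>m. m \<in> {0<..<1 - \<delta>} \<Longrightarrow> (Q has_real_derivative A2 m * g m) (at m)" by auto
  have Qc: "continuous_on {0<..<1 - \<delta>} Q"
    using Q by (blast intro: continuous_at_imp_continuous_on DERIV_isCont)
  then have "continuous_on {0<..<1 - \<delta>} (\<lambda>m. exp (Q m))" by (intro continuous_intros)
  from antiderivative_open_interval[OF _ _ this, of "1/2"] \<delta> obtain R where
    R0: "R (1/2) = 0" and R: "\<And>m. m \<in> {0<..<1 - \<delta>} \<Longrightarrow> (R has_real_derivative exp (Q m)) (at m)" by auto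
  have Qint: "integral {1/2..m} (\<lambda>z. A2 z * g z) = Q m" if "m \<in> {1/2..<1 - \<delta>}" for m
  proof -
    have "((\<lambda>z. A2 z * g z) has_integral Q m - Q (1/2)) {1/2..m}"
    proof (rule fundamental_theorem_of_calculus)
      fix x assume "x \<in> {1/2..m}"
      then have "(Q has_real_derivative A2 x * g x) (at x)" using that \<delta> by (intro Q) auto
      then show "(Q has_vector_derivative A2 x * g x) (at x within {1/2..m})"
        unfolding has_real_derivative_iff_has_vector_derivative[symmetric] by (rule has_field_derivative_at_within)
    qed (use that in auto)
    then show ?thesis using Q0 by (simp add: integral_unique)
  qed
  have logistic_L: "logistic L = 1 - \<delta>" "logistic (- L) = \<delta>"
    using logistic_logit[of "1 - \<delta>"] \<delta> by (auto simp: L_def logistic_minus)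
  have L: "0 < L" unfolding L_def using \<delta> by (simp add: field_simps)
  have range: "logistic y \<in> {\<delta><..<1 - \<delta>}" if "y \<in> {-L<..<L}" for y
    using that logistic_less_iff[of y L] logistic_less_iff[of "-L" y] logistic_L by auto
  have range': "logistic y \<in> {0<..<1 - \<delta>}" "logistic (- y) \<in> {0<..<1 - \<delta>}" if "y \<in> {-L<..<L}" for y
    using range[of y] range[of "-y"] that \<delta> by auto
  have rpos: "logistic y \<in> {1/2..<1 - \<delta>}" if "y \<in> {0..<L}" for y
    using that logistic_less_iff[of y L] logistic_le_iff[of 0 y] logistic_L by (auto simp: logistic_0)
  \<comment> \<open>The two weights move in opposite directions, which produces the difference of
    the two values of \<open>g\<close>; the term \<open>- y\<close> accounts for the shift by
    1.\<close>
  define p where "p y = Q (logistic y) + Q (logistic (- y)) - y" for y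
  define S where "S y = R (logistic y)" for y
  define s where "s y = exp (Q (logistic y)) * (logistic y * (1 - logistic y))" for y
  have dlm: "((\<lambda>y. logistic (- y)) has_real_derivative - (logistic (- y) * (1 - logistic (- y)))) (at y)" for y
  proof -
    have "(uminus has_real_derivative - 1) (at y)" by (auto intro!: derivative_eq_intros)
    from DERIV_chain2[OF DERIV_logistic this] show ?thesis by simp
  qed
  have dp: "(p has_real_derivative logit_drift g y - 1) (at y)" if y: "y \<in> {-L<..<L}" for y
  proof -
    have "(p has_real_derivative (A2 (logistic y) * g (logistic y) * (logistic y * (1 - logistic y))
        + A2 (logistic (- y)) * g (logistic (- y)) * (- (logistic (- y) * (1 - logistic (- y)))) - 1)) (at y)"
      unfolding p_def[abs_def]
      by (intro derivative_intros DERIV_chain2[OF Q] range'[OF y] DERIV_logistic dlm)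
    also have "A2 (logistic y) * g (logistic y) * (logistic y * (1 - logistic y))
        + A2 (logistic (- y)) * g (logistic (- y)) * (- (logistic (- y) * (1 - logistic (- y)))) - 1
      = (A2 (logistic y) * (logistic y * (1 - logistic y))) * g (logistic y)
        - (A2 (logistic (- y)) * (logistic (- y) * (1 - logistic (- y)))) * g (logistic (- y)) - 1"
      by (simp add: algebra_simps)
    also have "\<dots> = logit_drift g y - 1" unfolding A2_logistic by (simp add: logit_drift_def)
    finally show ?thesis .
  qed
  have dS: "(S has_real_derivative s y) (at y)" if y: "y \<in> {0..<L}" for y
    unfolding S_def[abs_def] s_def using y L by (intro DERIV_chain2[OF R] range' DERIV_logistic) auto
  \<comment> \<open>Beyond \<open>c\<close> the function \<open>g\<close> is nonnegative, so
    \<open>Q\<close> is nondecreasing there; on \<open>[\<delta>, c']\<close> it is bounded by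
    compactness. Together this bounds \<open>Q\<close> below on
    \<open>[1/2, 1 - \<delta>)\<close>.\<close>
  obtain c where c: "c < 1 - \<delta>" "\<And>m. c < m \<Longrightarrow> m < 1 - \<delta> \<Longrightarrow> 0 \<le> g m"
    using gl[unfolded filterlim_at_top, rule_format, of 0] \<delta> unfolding eventually_at_left_field by auto
  define c' where "c' = max (1/2) ((c + (1 - \<delta>)) / 2)"
  have "c < (c + (1 - \<delta>)) / 2" using c by simp
  then have c': "1/2 \<le> c'" "c < c'" "c' < 1 - \<delta>" using c \<delta> by (auto simp: c'_def less_max_iff_disj)
  have "continuous_on {\<delta>..c'} Q" using c' \<delta> by (intro continuous_on_subset[OF Qc]) auto
  from continuous_on_Icc_bounded[OF this] obtain B0 where
    B0: "0 \<le> B0" "\<And>m. m \<in> {\<delta>..c'} \<Longrightarrow> \<bar>Q m\<bar> \<le> B0" by blast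
  have Qlow: "- B0 \<le> Q m" if m: "m \<in> {1/2..<1 - \<delta>}" for m
  proof (cases "m \<le> c'")
    case True
    then show ?thesis using B0(2)[of m] m \<delta> by auto
  next
    case False
    have "Q c' \<le> Q m"
    proof (rule DERIV_nonneg_imp_nondecreasing[where f = Q])
      fix x assume x: "c' \<le> x" "x \<le> m"
      have "0 \<le> A2 x * g x"
        using x m c' c(2)[of x] \<delta> A2_pos[of x] by (intro mult_nonneg_nonneg) auto
      then show "\<exists>y. DERIV Q x :> y \<and> y \<ge> 0" using Q[of x] x m c' \<delta> by auto
    qed (use False in simp)
    then show ?thesis using B0(2)[of c'] c' \<delta> by auto
  qed
  \<comment> \<open>The factor \<open>2 / \<delta>\<close> undoes
    \<open>m * (1 - m) \<ge> \<delta> / 2\<close>, valid on \<open>[1/2, 1 - \<delta>)\<close>. The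
    exponent covers both \<open>\<bar>p y - q\<bar> \<le> B0 + L\<close> and, with
    \<open>q \<ge> - B0\<close>, the lower bound on \<open>p y\<close>.\<close>
  define B where "B = 2 / \<delta> * exp (2 * B0 + L)"
  have B1: "exp (2 * B0 + L) \<le> B" "0 < B" using \<delta> by (auto simp: B_def field_simps)
  have pQ: "\<bar>p y - Q (logistic \<bar>y\<bar>)\<bar> \<le> B0 + L" if y: "y \<in> {-L<..<L}" for y
  proof -
    have "p y - Q (logistic \<bar>y\<bar>) = Q (logistic (- \<bar>y\<bar>)) - y" by (auto simp: p_def abs_if)
    moreover have "logistic (- \<bar>y\<bar>) \<in> {\<delta>..c'}"
      using range[of "-\<bar>y\<bar>"] y c' logistic_le_iff[of "-\<bar>y\<bar>" 0] by (auto simp: logistic_0 abs_if split: if_splits)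
    ultimately show ?thesis using B0(2) y by (smt (verit) greaterThanLessThan_iff)
  qed
  have bounds: "s \<bar>y\<bar> \<le> B * exp (p y) \<and> exp (p y) \<le> B * s \<bar>y\<bar> \<and> exp (- p y) \<le> B" if y: "y \<in> {-L<..<L}" for y
  proof -
    define q where "q = Q (logistic \<bar>y\<bar>)"
    define w where "w = logistic \<bar>y\<bar> * (1 - logistic \<bar>y\<bar>)"
    have ry: "logistic \<bar>y\<bar> \<in> {1/2..<1 - \<delta>}" using y by (intro rpos) auto
    have w1: "w \<le> 1" unfolding w_def using ry \<delta> by (intro mult_le_one) auto
    have "1/2 * \<delta> \<le> w" unfolding w_def using ry \<delta> by (intro mult_mono) auto
    then have w2: "1 \<le> 2 / \<delta> * w" using \<delta> by (simp add: field_simps)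
    have q: "- B0 \<le> q" "q \<le> p y + (2 * B0 + L)" "p y \<le> (2 * B0 + L) + q" "- p y \<le> 2 * B0 + L"
      using Qlow[OF ry] pQ[OF y] B0(1) by (auto simp: q_def)
    have s: "s \<bar>y\<bar> = exp q * w" by (simp add: s_def q_def w_def)
    have "exp q * w \<le> exp q" using w1 by simp
    also have "\<dots> \<le> exp (p y + (2 * B0 + L))" using q by simp
    also have "\<dots> = exp (2 * B0 + L) * exp (p y)" by (simp add: exp_add)
    also have "\<dots> \<le> B * exp (p y)" using B1 by (intro mult_right_mono) auto
    finally have "s \<bar>y\<bar> \<le> B * exp (p y)" by (simp add: s)
    moreover have "exp (p y) \<le> B * s \<bar>y\<bar>"
    proof -
      have "exp (p y) \<le> exp (2 * B0 + L) * exp q * 1" using q by (simp flip: exp_add)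
      also have "\<dots> \<le> exp (2 * B0 + L) * exp q * (2 / \<delta> * w)" using w2 by (intro mult_left_mono) auto
      finally show ?thesis by (simp add: s B_def mult_ac)
    qed
    moreover have "exp (- p y) \<le> B" using q B1(1) by (meson exp_le_cancel_iff order_trans)
    ultimately show ?thesis by blast
  qed
  have "(\<integral>\<^sup>+ y. ennreal (exp (integral {1/2..y} (\<lambda>z. A2 z * g z))) * indicator {1/2..<1 - \<delta>} y \<partial>lborel)
      = (\<integral>\<^sup>+ y. ennreal (exp (Q y)) * indicator {1/2..<1 - \<delta>} y \<partial>lborel)"
    by (intro nn_integral_cong) (auto simp: indicator_def Qint)
  moreover have "(\<integral>\<^sup>+ y. ennreal (exp (Q y)) * indicator {1/2..<1 - \<delta>} y \<partial>lborel) = \<infinity>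
      \<longleftrightarrow> (\<forall>K. \<exists>m\<in>{1/2..<1 - \<delta>}. K \<le> R m)"
    using \<delta> R R0 by (intro nn_integral_exp_eq_top_iff continuous_on_subset[OF Qc]) auto
  moreover have "(\<exists>m\<in>{1/2..<1 - \<delta>}. K \<le> R m) \<longleftrightarrow> (\<exists>y\<in>{0..<L}. K \<le> S y)" for K
  proof
    assume "\<exists>m\<in>{1/2..<1 - \<delta>}. K \<le> R m"
    then obtain m where m: "m \<in> {1/2..<1 - \<delta>}" "K \<le> R m" by blast
    define y where "y = ln (m / (1 - m))"
    have y: "logistic y = m" unfolding y_def using m \<delta> by (intro logistic_logit) auto
    have "y \<in> {0..<L}" using m logistic_le_iff[of 0 y] logistic_less_iff[of y L] by (auto simp: y logistic_0 logistic_L)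
    then show "\<exists>y\<in>{0..<L}. K \<le> S y" using m y by (auto simp: S_def intro!: bexI[of _ y])
  qed (use rpos in \<open>auto simp: S_def\<close>)
  ultimately show ?thesis
    using B1(2) dp dS bounds by (intro exI[of _ p] exI[of _ S] exI[of _ s] exI[of _ B]) simp
qed

section \<open>Lyapunov functions for Feller's test\<close>

text \<open>With the integrating factor \<open>exp (- p)\<close>, the equation
  \<open>u' = 1 + H u\<close> becomes \<open>(exp (- p) u)' = exp (- p)\<close>, so
  \<open>u = exp p * E\<close>. At the base point \<open>b\<close> the sign of \<open>f'\<close>
  changes; its position decides the shape of \<open>f\<close>.\<close>

lemma lyapunov_antiderivatives:
  fixes p H :: "real \<Rightarrow> real"
  assumes p: "\<And>y. y \<in> {-L<..<L} \<Longrightarrow> (p has_real_derivative H y) (at y)" and b: "-L < b" "b < L"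
  shows "\<exists>E f. E b = 0 \<and> f b = 0 \<and> (\<forall>y\<in>{-L<..<L}. (E has_real_derivative exp (- p y)) (at y) \<and>
    (f has_real_derivative exp (p y) * E y) (at y) \<and>
    ((\<lambda>y. exp (p y) * E y) has_real_derivative 1 + H y * (exp (p y) * E y)) (at y))"
proof -
  have pc: "continuous_on {-L<..<L} p"
    using p by (blast intro: continuous_at_imp_continuous_on DERIV_isCont)
  then have "continuous_on {-L<..<L} (\<lambda>y. exp (- p y))" by (intro continuous_intros)
  from antiderivative_open_interval[OF b this] obtain E where
    E: "E b = 0" "\<And>y. y \<in> {-L<..<L} \<Longrightarrow> (E has_real_derivative exp (- p y)) (at y)" by blast
  have "continuous_on {-L<..<L} E"
    using E(2) by (blast intro: continuous_at_imp_continuous_on DERIV_isCont)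
  then have "continuous_on {-L<..<L} (\<lambda>y. exp (p y) * E y)" using pc by (intro continuous_intros)
  from antiderivative_open_interval[OF b this] obtain f where
    f: "f b = 0" "\<And>y. y \<in> {-L<..<L} \<Longrightarrow> (f has_real_derivative exp (p y) * E y) (at y)" by blast
  have "((\<lambda>y. exp (p y) * E y) has_real_derivative 1 + H y * (exp (p y) * E y)) (at y)" if "y \<in> {-L<..<L}" for y
    using p[OF that] E(2)[OF that] by (auto intro!: derivative_eq_intros simp: exp_minus)
  then show ?thesis using E f by blast
qed

lemma increment_ge_scaled:
  fixes F S :: "real \<Rightarrow> real"
  assumes "r \<le> x"
    and F: "\<And>t. r \<le> t \<Longrightarrow> t \<le> x \<Longrightarrow> (F has_real_derivative U t) (at t)"
    and S: "\<And>t. r \<le> t \<Longrightarrow> t \<le> x \<Longrightarrow> (S has_real_derivative s t) (at t)"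
    and le: "\<And>t. r \<le> t \<Longrightarrow> t \<le> x \<Longrightarrow> c * s t \<le> U t"
  shows "F r + c * (S x - S r) \<le> F x"
proof -
  have "F r - c * S r \<le> F x - c * S x"
  proof (rule DERIV_nonneg_imp_nondecreasing[where f = "\<lambda>t. F t - c * S t"])
    fix t assume t: "r \<le> t" "t \<le> x"
    have "((\<lambda>t. F t - c * S t) has_real_derivative U t - c * s t) (at t)"
      using F[OF t] S[OF t] by (auto intro!: derivative_eq_intros)
    then show "\<exists>y. ((\<lambda>t. F t - c * S t) has_real_derivative y) (at t) \<and> 0 \<le> y" using le[OF t] by auto
  qed fact
  then show ?thesis by (simp add: algebra_simps)
qed

lemma DERIV_reflect:
  assumes "(f has_real_derivative d) (at (- x))"
  shows "((\<lambda>x. f (- x)) has_real_derivative - d) (at (x::real))"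
proof -
  have "(uminus has_real_derivative - 1) (at x)" by (auto intro!: derivative_eq_intros)
  from DERIV_chain2[OF assms this] show ?thesis by simp
qed

text \<open>Based at 0, \<open>E\<close> has the sign of \<open>y\<close>, so \<open>f\<close> has
  its minimum 0 there. Away from 0, \<open>\<bar>E\<bar>\<close> is bounded below, so towards both
  ends \<open>f\<close> grows at least like a multiple of \<open>S \<bar>y\<bar>\<close>, which is
  unbounded.\<close>

lemma nonexplosion_function:
  fixes g :: "real \<Rightarrow> real"
  assumes \<delta>: "0 < \<delta>" "\<delta> < 1 / 2" and g: "admissible \<delta> g"
    and inf: "(\<integral>\<^sup>+ y. ennreal (exp (integral {1/2..y} (\<lambda>z. A2 z * g z))) * indicator {1/2..<1 - \<delta>} y \<partial>lborel) = \<infinity>"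
  defines "L \<equiv> ln ((1 - \<delta>) / \<delta>)"
  shows "\<exists>f u. (\<forall>y\<in>{-L<..<L}. (f has_real_derivative u y) (at y) \<and>
      (u has_real_derivative 1 + (logit_drift g y - 1) * u y) (at y) \<and> 0 \<le> f y) \<and>
    (\<forall>m. \<exists>\<beta>\<in>{0<..<L}. \<forall>y\<in>{-L<..<L}. \<beta> \<le> \<bar>y\<bar> \<longrightarrow> m \<le> f y)"
proof -
  have L: "0 < L" unfolding L_def using \<delta> by (simp add: field_simps)
  obtain p S s B where B: "0 < B"
    and p': "\<forall>y\<in>{-L<..<L}. (p has_real_derivative logit_drift g y - 1) (at y)"
    and S': "\<forall>y\<in>{0..<L}. (S has_real_derivative s y) (at y)"
    and b': "\<forall>y\<in>{-L<..<L}. s \<bar>y\<bar> \<le> B * exp (p y) \<and> exp (p y) \<le> B * s \<bar>y\<bar> \<and> exp (- p y) \<le> B"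
    and scale: "(\<integral>\<^sup>+ y. ennreal (exp (integral {1/2..y} (\<lambda>z. A2 z * g z))) * indicator {1/2..<1 - \<delta>} y \<partial>lborel) = \<infinity>
        \<longleftrightarrow> (\<forall>K. \<exists>y\<in>{0..<L}. K \<le> S y)"
    using scale_function[OF \<delta> g, folded L_def] by (elim exE conjE) (rule that; assumption)
  note p = p'[rule_format] and S = S'[rule_format]
  have b: "\<And>y. y \<in> {-L<..<L} \<Longrightarrow> s \<bar>y\<bar> \<le> B * exp (p y)" "\<And>y. y \<in> {-L<..<L} \<Longrightarrow> exp (p y) \<le> B * s \<bar>y\<bar>"
    using b' by blast+
  have unb: "\<exists>y\<in>{0..<L}. K \<le> S y" for K
    using inf scale by blast
  have "-L < 0" using L by simp
  from lyapunov_antiderivatives[OF p this L] obtain E f where E0: "E 0 = 0" and f0: "f 0 = 0"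
    and E: "\<And>y. y \<in> {-L<..<L} \<Longrightarrow> (E has_real_derivative exp (- p y)) (at y)"
    and f: "\<And>y. y \<in> {-L<..<L} \<Longrightarrow> (f has_real_derivative exp (p y) * E y) (at y)"
    and u: "\<And>y. y \<in> {-L<..<L} \<Longrightarrow>
      ((\<lambda>y. exp (p y) * E y) has_real_derivative 1 + (logit_drift g y - 1) * (exp (p y) * E y)) (at y)"
    by blast
  have Emono: "E x < E y" if "-L < x" "x < y" "y < L" for x y
  proof (rule DERIV_pos_imp_increasing[OF that(2)])
    fix t assume "x \<le> t" "t \<le> y"
    then show "\<exists>d. DERIV E t :> d \<and> 0 < d" using E[of t] that by (intro exI[of _ "exp (- p t)"]) auto
  qed
  \<comment> \<open>Any radius strictly between 0 and \<open>L\<close> would do: \<open>E\<close>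
    vanishes at 0, so a positive lower bound on \<open>\<bar>E\<bar>\<close> is available only away
    from 0.\<close>
  define r where "r = L / 2"
  have r: "0 < r" "r < L" using L by (auto simp: r_def)
  define e where "e = min (E r) (- E (- r))"
  have e: "0 < e" using Emono[of 0 r] Emono[of "-r" 0] r E0 by (auto simp: e_def)
  have spos: "0 \<le> s y" if "y \<in> {0..<L}" for y
  proof -
    have "0 \<le> B * s y" using b(2)[of y] that by (smt (verit) atLeastLessThan_iff exp_gt_zero greaterThanLessThan_iff)
    then show ?thesis using B by (simp add: zero_le_mult_iff)
  qed
  have Smono: "S x \<le> S y" if "0 \<le> x" "x \<le> y" "y < L" for x y
  proof (rule DERIV_nonneg_imp_nondecreasing[OF that(2)])
    fix t assume "x \<le> t" "t \<le> y"
    then show "\<exists>d. DERIV S t :> d \<and> 0 \<le> d" using S[of t] spos[of t] that by (intro exI[of _ "s t"]) auto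
  qed
  have fnn: "0 \<le> f y" if y: "y \<in> {-L<..<L}" for y
  proof (cases "0 \<le> y")
    case True
    have "f 0 \<le> f y"
    proof (rule DERIV_nonneg_imp_nondecreasing[OF True])
      fix x assume x: "0 \<le> x" "x \<le> y"
      then have "0 \<le> E x" using Emono[of 0 x] E0 y L by (cases "x = 0") auto
      then show "\<exists>d. DERIV f x :> d \<and> 0 \<le> d" using f[of x] x y L by auto
    qed
    then show ?thesis by (simp add: f0)
  next
    case False
    then have "y \<le> 0" by simp
    then have "f 0 \<le> f y"
    proof (rule DERIV_nonpos_imp_nonincreasing)
      fix x assume x: "y \<le> x" "x \<le> 0"
      then have "E x \<le> 0" using Emono[of x 0] E0 y L by (cases "x = 0") auto
      then show "\<exists>d. DERIV f x :> d \<and> d \<le> 0"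
        using f[of x] x y L by (intro exI[of _ "exp (p x) * E x"]) (auto simp: mult_le_0_iff)
    qed
    then show ?thesis by (simp add: f0)
  qed
  have grow: "e / B * (S \<bar>y\<bar> - S r) \<le> f y" if y: "y \<in> {-L<..<L}" "r \<le> \<bar>y\<bar>" for y
  proof -
    have sb: "e / B * s \<bar>t\<bar> \<le> e * exp (p t)" if "t \<in> {-L<..<L}" for t
      using b(1)[OF that] e B by (simp add: field_simps)
    have "f r + e / B * (S \<bar>y\<bar> - S r) \<le> f \<bar>y\<bar>" if "0 \<le> y"
    proof (rule increment_ge_scaled[OF y(2)])
      fix t assume t: "r \<le> t" "t \<le> \<bar>y\<bar>"
      then have tL: "t \<in> {-L<..<L}" using y r by auto
      show "(f has_real_derivative exp (p t) * E t) (at t)" using f[OF tL] .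
      show "(S has_real_derivative s t) (at t)" using S[of t] tL t r by auto
      have "e \<le> E t" using Emono[of r t] t tL r by (cases "t = r") (auto simp: e_def)
      then have "e * exp (p t) \<le> exp (p t) * E t" by (simp add: mult.commute)
      moreover have "\<bar>t\<bar> = t" using t r by simp
      ultimately show "e / B * s t \<le> exp (p t) * E t" using sb[OF tL] by (metis order_trans)
    qed
    moreover have "f (- r) + e / B * (S \<bar>y\<bar> - S r) \<le> f (- \<bar>y\<bar>)" if "y < 0"
    proof (rule increment_ge_scaled[OF y(2), of "\<lambda>t. f (- t)"])
      fix t assume t: "r \<le> t" "t \<le> \<bar>y\<bar>"
      then have tL: "- t \<in> {-L<..<L}" using y r by auto
      show "((\<lambda>t. f (- t)) has_real_derivative - (exp (p (- t)) * E (- t))) (at t)"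
        by (rule DERIV_reflect[OF f[OF tL]])
      show "(S has_real_derivative s t) (at t)" using S[of t] tL t r by auto
      have "E (- t) \<le> - e" using Emono[of "- t" "- r"] t tL r by (cases "t = r") (auto simp: e_def)
      then have "e * exp (p (- t)) \<le> - E (- t) * exp (p (- t))" by (intro mult_right_mono) auto
      then have "e * exp (p (- t)) \<le> - (exp (p (- t)) * E (- t))" by (simp add: mult.commute)
      moreover have "\<bar>- t\<bar> = t" using t r by simp
      ultimately show "e / B * s t \<le> - (exp (p (- t)) * E (- t))" using sb[OF tL] by (metis order_trans)
    qed
    moreover have "0 \<le> f r" "0 \<le> f (- r)" using r by (auto intro: fnn)
    ultimately show ?thesis by (cases "0 \<le> y") (auto simp: abs_if)
  qed
  have "\<exists>\<beta>\<in>{0<..<L}. \<forall>y\<in>{-L<..<L}. \<beta> \<le> \<bar>y\<bar> \<longrightarrow> m \<le> f y" for m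
  proof -
    obtain y1 where y1: "y1 \<in> {0..<L}" "S r + m * B / e \<le> S y1" using unb by blast
    have "m \<le> f y" if y: "y \<in> {-L<..<L}" "max y1 r \<le> \<bar>y\<bar>" for y
    proof -
      have "S r + m * B / e \<le> S \<bar>y\<bar>" using y1 Smono[of y1 "\<bar>y\<bar>"] y by (simp add: abs_less_iff)
      then have "m \<le> e / B * (S \<bar>y\<bar> - S r)" using e B by (simp add: field_simps)
      also have "\<dots> \<le> f y" using y by (intro grow) auto
      finally show ?thesis .
    qed
    then show ?thesis using y1 r by (intro bexI[of _ "max y1 r"]) auto
  qed
  then show ?thesis
    using f u fnn by (intro exI[of _ f] exI[of _ "\<lambda>y. exp (p y) * E y"] conjI ballI allI) auto
qed

text \<open>With the base point \<open>b\<close> to the right of \<open>y0\<close>, \<open>E\<close>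
  is negative and \<open>f\<close> decreases on \<open>(-L, b)\<close>. As
  \<open>exp (- p) \<le> B\<close> on a bounded interval, \<open>E\<close> is bounded, so
  \<open>- f'\<close> is at most a multiple of \<open>s \<bar>y\<bar>\<close>; a bounded
  \<open>S\<close> then keeps \<open>f\<close> bounded at \<open>-L\<close>. Subtracting
  \<open>f \<beta>\<close> makes the function positive at \<open>y0\<close> and nonpositive on
  \<open>[\<beta>, b]\<close>, so exits above contribute nothing positive.\<close>

lemma explosion_function:
  fixes g :: "real \<Rightarrow> real"
  assumes \<delta>: "0 < \<delta>" "\<delta> < 1 / 2" and g: "admissible \<delta> g"
    and fin: "(\<integral>\<^sup>+ y. ennreal (exp (integral {1/2..y} (\<lambda>z. A2 z * g z))) * indicator {1/2..<1 - \<delta>} y \<partial>lborel) \<noteq> \<infinity>"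
  defines "L \<equiv> ln ((1 - \<delta>) / \<delta>)"
  assumes y0: "y0 \<in> {-L<..<L}"
  shows "\<exists>f u C \<beta> b. (\<forall>y\<in>{-L<..<L}. (f has_real_derivative u y) (at y) \<and>
      (u has_real_derivative 1 + (logit_drift g y - 1) * u y) (at y)) \<and>
    y0 < \<beta> \<and> \<beta> < b \<and> b < L \<and> 0 < f y0 \<and> (\<forall>y\<in>{-L<..b}. f y \<le> C) \<and> (\<forall>y\<in>{\<beta>..b}. f y \<le> 0)"
proof -
  have L: "0 < L" unfolding L_def using \<delta> by (simp add: field_simps)
  obtain p S s B where B: "0 < B"
    and p': "\<forall>y\<in>{-L<..<L}. (p has_real_derivative logit_drift g y - 1) (at y)"
    and S': "\<forall>y\<in>{0..<L}. (S has_real_derivative s y) (at y)"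
    and b': "\<forall>y\<in>{-L<..<L}. s \<bar>y\<bar> \<le> B * exp (p y) \<and> exp (p y) \<le> B * s \<bar>y\<bar> \<and> exp (- p y) \<le> B"
    and scale: "(\<integral>\<^sup>+ y. ennreal (exp (integral {1/2..y} (\<lambda>z. A2 z * g z))) * indicator {1/2..<1 - \<delta>} y \<partial>lborel) = \<infinity>
        \<longleftrightarrow> (\<forall>K. \<exists>y\<in>{0..<L}. K \<le> S y)"
    using scale_function[OF \<delta> g, folded L_def] by (elim exE conjE) (rule that; assumption)
  note p = p'[rule_format] and S = S'[rule_format]
  have eb: "\<And>y. y \<in> {-L<..<L} \<Longrightarrow> exp (p y) \<le> B * s \<bar>y\<bar>" "\<And>y. y \<in> {-L<..<L} \<Longrightarrow> exp (- p y) \<le> B"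
    using b' by blast+
  obtain K where "\<forall>y\<in>{0..<L}. S y < K"
    using fin scale by (auto simp: not_le)
  note K = this[rule_format]
  \<comment> \<open>Placing \<open>b\<close> beyond 0 as well lets the estimate towards
    \<open>-L\<close> start at 0, from where \<open>S\<close> is controlled.\<close>
  define w where "w = max y0 0"
  have w: "y0 \<le> w" "0 \<le> w" "w < L" using y0 L by (auto simp: w_def)
  define b where "b = (w + L) / 2"
  define \<beta> where "\<beta> = (w + b) / 2"
  have "w < b" "b < L" using w by (auto simp: b_def)
  moreover from this have "w < \<beta>" "\<beta> < b" by (auto simp: \<beta>_def)
  ultimately have b: "0 < b" "y0 < \<beta>" "0 < \<beta>" "\<beta> < b" "b < L" "-L < b" using w L by auto
  from lyapunov_antiderivatives[OF p b(6,5)] obtain E f where E0: "E b = 0" and f0: "f b = 0"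
    and E: "\<And>y. y \<in> {-L<..<L} \<Longrightarrow> (E has_real_derivative exp (- p y)) (at y)"
    and f: "\<And>y. y \<in> {-L<..<L} \<Longrightarrow> (f has_real_derivative exp (p y) * E y) (at y)"
    and u: "\<And>y. y \<in> {-L<..<L} \<Longrightarrow>
      ((\<lambda>y. exp (p y) * E y) has_real_derivative 1 + (logit_drift g y - 1) * (exp (p y) * E y)) (at y)"
    by blast
  have Eneg: "E y < 0" if "-L < y" "y < b" for y
  proof -
    have "E y < E b"
    proof (rule DERIV_pos_imp_increasing[OF that(2)])
      fix x assume "y \<le> x" "x \<le> b"
      then show "\<exists>d. DERIV E x :> d \<and> 0 < d" using E[of x] that b by (intro exI[of _ "exp (- p x)"]) auto
    qed
    then show ?thesis by (simp add: E0)
  qed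
  have Elow: "- (2 * L * B) \<le> E y" if "-L < y" "y \<le> b" for y
  proof -
    have "B * y - E y \<le> B * b - E b"
    proof (rule DERIV_nonneg_imp_nondecreasing[OF that(2), where f = "\<lambda>x. B * x - E x"])
      fix x assume "y \<le> x" "x \<le> b"
      then have x: "x \<in> {-L<..<L}" using that b by auto
      have "((\<lambda>x. B * x - E x) has_real_derivative B - exp (- p x)) (at x)"
        using E[OF x] by (auto intro!: derivative_eq_intros)
      then show "\<exists>d. ((\<lambda>x. B * x - E x) has_real_derivative d) (at x) \<and> 0 \<le> d" using eb(2)[OF x] by auto
    qed
    moreover have "B * (b - y) \<le> B * (2 * L)" using B that b by (intro mult_left_mono) auto
    ultimately show ?thesis by (simp add: E0 algebra_simps)
  qed
  have fdec: "f y < f x" if "-L < x" "x < y" "y \<le> b" for x y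
  proof (rule DERIV_neg_imp_decreasing_open[OF that(2)])
    fix t assume "x < t" "t < y"
    then show "\<exists>d. DERIV f t :> d \<and> d < 0"
      using f[of t] Eneg[of t] that b by (intro exI[of _ "exp (p t) * E t"]) (auto simp: mult_less_0_iff)
  next
    show "continuous_on {x..y} f"
      using that b by (intro DERIV_continuous_on[OF DERIV_subset[OF f]]) auto
  qed
  \<comment> \<open>\<open>2 * L * B\<close> bounds \<open>- E\<close>; the last factor
    \<open>B\<close> comes from \<open>exp p \<le> B * s\<close>.\<close>
  define c where "c = 2 * L * B * B"
  have c0: "0 \<le> c" using L B by (simp add: c_def)
  define C where "C = f 0 + c * (K - S 0)"
  have SK: "S 0 < K" using K[of 0] L by simp
  have fC: "f y \<le> C" if y: "-L < y" "y \<le> b" for y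
  proof (cases "0 < y")
    case True
    then have "f y \<le> f 0" using fdec[of 0 y] that L by simp
    then show ?thesis using c0 SK by (simp add: C_def add_increasing2)
  next
    case False
    have "- f (- 0) + (- c) * (S (- y) - S 0) \<le> - f (- (- y))"
    proof (rule increment_ge_scaled)
      fix t assume t: "0 \<le> t" "t \<le> - y"
      then have tL: "- t \<in> {-L<..<L}" using y L by auto
      show "((\<lambda>t. - f (- t)) has_real_derivative exp (p (- t)) * E (- t)) (at t)"
        using DERIV_minus[OF DERIV_reflect[OF f[OF tL]]] by simp
      show "(S has_real_derivative s t) (at t)" using S[of t] tL t by auto
      have st: "exp (p (- t)) \<le> B * s t" using eb(1)[OF tL] t by simp
      have "- E (- t) \<le> 2 * L * B" using Elow[of "- t"] tL t b by auto
      moreover have "0 \<le> - E (- t)" using Eneg[of "- t"] tL t b by auto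
      ultimately have "exp (p (- t)) * (- E (- t)) \<le> (B * s t) * (2 * L * B)"
        using st by (intro mult_mono) (auto intro: order_trans[OF exp_ge_zero])
      then show "- c * s t \<le> exp (p (- t)) * E (- t)" by (simp add: c_def algebra_simps)
    qed (use False in simp)
    moreover have "c * (S (- y) - S 0) \<le> c * (K - S 0)"
      using K[of "- y"] y False by (intro mult_left_mono c0) auto
    ultimately show ?thesis by (simp add: C_def)
  qed
  show ?thesis
  proof (rule exI[of _ "\<lambda>y. f y - f \<beta>"], rule exI[of _ "\<lambda>y. exp (p y) * E y"], rule exI[of _ "C - f \<beta>"],
      rule exI[of _ \<beta>], rule exI[of _ b], intro conjI ballI)
    fix y assume "y \<in> {-L<..<L}"
    then show "((\<lambda>y. f y - f \<beta>) has_real_derivative exp (p y) * E y) (at y)"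
      using f by (auto intro!: derivative_eq_intros)
  next
    fix y assume "y \<in> {\<beta>..b}"
    then show "f y - f \<beta> \<le> 0" using fdec[of \<beta> y] b L by (cases "y = \<beta>") auto
  qed (use u b fC fdec[of y0 \<beta>] y0 in auto)
qed

section \<open>Exit probabilities\<close>

lemma euler_frozen:
  assumes "j \<le> k" "euler H \<alpha> \<beta> D y x j \<notin> {\<alpha>..\<beta>}"
  shows "euler H \<alpha> \<beta> D y x k = euler H \<alpha> \<beta> D y x j"
  using assms
proof (induction k rule: dec_induct)
  case (step k)
  then have "indicator {\<alpha>..\<beta>} (euler H \<alpha> \<beta> D y x k) = (0::real)" by (intro indicator_simps(2)) simp
  then show ?case using step by (simp add: Let_def)
qed simp

section \<open>Limit-inferior events\<close>

text \<open>Fatou's lemma for sets: a tail intersection lies in every later \<open>C k\<close>, and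
  tail intersections increase to their union.\<close>

lemma (in prob_space) prob_liminf_le:
  assumes C: "\<And>n. C n \<in> events" and c: "eventually (\<lambda>n. prob (C n) \<le> c) sequentially"
  shows "(\<Union>n. \<Inter>k\<in>{n..}. C k) \<in> events" "prob (\<Union>n. \<Inter>k\<in>{n..}. C k) \<le> c"
proof -
  define I where "I n = (\<Inter>k\<in>{n..}. C k)" for n :: nat
  have I: "I n \<in> events" for n unfolding I_def using C by (intro sets.countable_INT') auto
  then show "(\<Union>n. \<Inter>k\<in>{n..}. C k) \<in> events" unfolding I_def[symmetric] by auto
  have inc: "incseq I" unfolding I_def by (intro incseq_SucI INF_superset_mono) auto
  have "prob (I n) \<le> c" for n
  proof -
    obtain m where m: "\<And>k. m \<le> k \<Longrightarrow> prob (C k) \<le> c" using c by (auto simp: eventually_sequentially)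
    have "prob (I n) \<le> prob (C (max m n))" using C by (intro finite_measure_mono) (auto simp: I_def)
    also have "\<dots> \<le> c" by (intro m) simp
    finally show ?thesis .
  qed
  moreover have "(\<lambda>n. prob (I n)) \<longlonglongrightarrow> prob (\<Union>n. I n)"
    using I inc by (intro finite_Lim_measure_incseq) auto
  ultimately show "prob (\<Union>n. \<Inter>k\<in>{n..}. C k) \<le> c"
    unfolding I_def[symmetric] by (intro LIMSEQ_le_const2) auto
qed

text \<open>The bad events may vary with the mesh, and the mesh needed by the comparison depends on
  the path. Infinitely many good meshes per path suffice, since one of them lies beyond any
  threshold. Failure at every level \<open>r\<close> has probability at most
  \<open>1 / real (Suc r)\<close> for each \<open>r\<close>, hence 0.\<close>

lemma (in prob_space) AE_frequently_notin:
  assumes B: "\<And>r n. B r n \<in> events"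
    and c: "\<And>r::nat. eventually (\<lambda>n::nat. prob (B r n) \<le> 1 / real (Suc r)) sequentially"
  shows "AE \<omega> in M. \<exists>r. \<forall>n. \<exists>k\<ge>n. \<omega> \<notin> B r k"
proof -
  define F where "F r = (\<Union>n. \<Inter>k\<in>{n..}. B r k)" for r
  have F: "F r \<in> events" "prob (F r) \<le> 1 / real (Suc r)" for r
    unfolding F_def using prob_liminf_le[of "B r", OF B c] by auto
  have "prob (\<Inter>r. F r) \<le> 1 / real (Suc r)" for r
    using F by (intro order_trans[OF finite_measure_mono F(2)]) auto
  then have "prob (\<Inter>r. F r) \<le> 0"
    by (intro LIMSEQ_le_const[OF LIMSEQ_Suc[OF lim_1_over_n]]) auto
  then have "prob (\<Inter>r. F r) = 0" using measure_nonneg[of M] by (simp add: antisym)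
  moreover have "(\<Inter>r. F r) \<in> events" using F by auto
  ultimately have "(\<Inter>r. F r) \<in> null_sets M" by (simp add: null_sets_def emeasure_eq_measure)
  from AE_not_in[OF this] show ?thesis by eventually_elim (auto simp: F_def Bex_def)
qed

text \<open>Staying outside \<open>A r k\<close> for all large \<open>r\<close> and then all large
  \<open>k\<close> means lying in an iterated limit inferior of complements, of probability at most
  \<open>1 - q\<close> since \<open>q\<close> is the same for all \<open>r\<close>.\<close>

lemma (in prob_space) not_AE_eventually_notin:
  assumes A: "\<And>r n. A r n \<in> events" and q: "0 < q"
    and c: "\<And>r::nat. eventually (\<lambda>n::nat. q \<le> prob (A r n)) sequentially"
  shows "\<not> (AE \<omega> in M. \<exists>r0. \<forall>r\<ge>r0. \<exists>n. \<forall>k\<ge>n. \<omega> \<notin> A r k)"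
proof
  assume AE: "AE \<omega> in M. \<exists>r0. \<forall>r\<ge>r0. \<exists>n. \<forall>k\<ge>n. \<omega> \<notin> A r k"
  define F where "F r = (\<Union>n. \<Inter>k\<in>{n..}. space M - A r k)" for r
  have F: "F r \<in> events" "prob (F r) \<le> 1 - q" for r
  proof -
    have "eventually (\<lambda>n. prob (space M - A r n) \<le> 1 - q) sequentially"
      using c[of r] by eventually_elim (use A in \<open>simp add: prob_compl\<close>)
    from prob_liminf_le[OF _ this] A show "F r \<in> events" "prob (F r) \<le> 1 - q" by (auto simp: F_def)
  qed
  define G where "G = (\<Union>r0. \<Inter>r\<in>{r0..}. F r)"
  have G: "G \<in> events" "prob G \<le> 1 - q" unfolding G_def using prob_liminf_le[of F "1 - q"] F by auto
  have "AE \<omega> in M. \<omega> \<in> G"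
    using AE AE_space by eventually_elim (fastforce simp: G_def F_def)
  then have "prob G = 1" using G prob_eq_1 by simp
  then show False using G q by simp
qed

section \<open>Exit estimates for chains\<close>

context
  fixes M :: "'a measure" and N :: "real \<Rightarrow> 'a \<Rightarrow> real" and f u H :: "real \<Rightarrow> real" and L T y0 :: real
  assumes noise: "noise M N" and T: "0 < T"
    and H: "continuous_on {-L<..<L} H"
    and f: "\<And>y. y \<in> {-L<..<L} \<Longrightarrow> (f has_real_derivative u y) (at y)"
    and u: "\<And>y. y \<in> {-L<..<L} \<Longrightarrow> (u has_real_derivative 1 + H y * u y) (at y)"
begin

lemma continuous_on_f: "continuous_on {-L<..<L} f"
  using f by (blast intro: continuous_at_imp_continuous_on DERIV_isCont)

lemma euler_exit_limit:
  assumes ab: "-L < a" "a < \<alpha>" "\<alpha> \<le> \<beta>" "\<beta> < b" "b < L"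
  shows "(\<lambda>n. (\<integral>\<omega>. clamped f a b (euler H \<alpha> \<beta> (T / real n) y0 (increment N (T / real n) \<omega>) n) \<partial>M)
      - (\<Sum>k<n. T / real n * measure M {\<omega> \<in> space M. euler H \<alpha> \<beta> (T / real n) y0 (increment N (T / real n) \<omega>) k \<in> {\<alpha>..\<beta>}}))
    \<longlonglongrightarrow> clamped f a b y0"
proof (rule euler_expectation_limit[OF noise _ _ _ _ _ ab(2-4) T])
  have "continuous_on {-L<..<L} u"
    using u by (blast intro: continuous_at_imp_continuous_on DERIV_isCont)
  then have "continuous_on {-L<..<L} (\<lambda>y. 1 + H y * u y)" using H by (intro continuous_intros)
  then show "continuous_on {a..b} (\<lambda>y. 1 + H y * u y)"
    by (rule continuous_on_subset) (use ab in auto)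
  show "continuous_on {\<alpha>..\<beta>} H" by (rule continuous_on_subset[OF H]) (use ab in auto)
qed (use f u ab in auto)

lemma euler_terminal_measurable:
  assumes "-L < \<alpha>" "\<beta> < L" "0 < n"
  shows "(\<lambda>\<omega>. euler H \<alpha> \<beta> (T / real n) y0 (increment N (T / real n) \<omega>) k) \<in> borel_measurable M"
proof (rule euler_measurable)
  show "continuous_on {\<alpha>..\<beta>} H" by (rule continuous_on_subset[OF H]) (use assms in auto)
  fix j
  have "0 < T / real n" using T assms by simp
  then have "has_bochner_integral M (\<lambda>\<omega>. increment N (T / real n) \<omega> j) 0"
    using noise unfolding noise_def by blast
  then show "(\<lambda>\<omega>. increment N (T / real n) \<omega> j) \<in> borel_measurable M"
    by (auto simp: has_bochner_integral_iff)
qed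

lemma clamped_f_measurable:
  assumes ab: "-L < a" "a \<le> b" "b < L"
  shows "clamped f a b \<in> borel_measurable borel"
proof (rule borel_measurable_continuous_onI)
  have "continuous_on UNIV (\<lambda>y. max a (min b y))" by (intro continuous_intros)
  then show "continuous_on UNIV (clamped f a b)"
    by (rule continuous_on_compose2[OF continuous_on_f]) (use ab in auto)
qed

lemma clamped_f_bounded:
  assumes ab: "-L < a" "a \<le> b" "b < L"
  shows "\<exists>C. \<forall>y. norm (clamped f a b y) \<le> C"
proof -
  have "continuous_on {a..b} f" by (rule continuous_on_subset[OF continuous_on_f]) (use ab in auto)
  from continuous_on_Icc_bounded[OF this] obtain C where C: "\<And>y. y \<in> {a..b} \<Longrightarrow> \<bar>f y\<bar> \<le> C" by blast
  show ?thesis unfolding real_norm_def by (intro exI[of _ C] allI C) (use ab in auto)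
qed

text \<open>Markov's inequality: an exited chain has \<open>f \<ge> m\<close>, while the mean of
  \<open>f\<close> at the end is about \<open>f y0\<close> plus the mean lifetime, which is at most
  \<open>T\<close>. The summand 1 absorbs the discretization error.\<close>

lemma euler_exit_prob_le:
  assumes nn: "\<And>y. y \<in> {-L<..<L} \<Longrightarrow> 0 \<le> f y" and m: "0 < m"
    and big: "\<And>y. y \<in> {-L<..<L} - {\<alpha>..\<beta>} \<Longrightarrow> m \<le> f y"
    and ab: "-L < \<alpha>" "\<alpha> \<le> y0" "y0 \<le> \<beta>" "\<beta> < L"
  shows "eventually (\<lambda>n. measure M {\<omega> \<in> space M.
      euler H \<alpha> \<beta> (T / real n) y0 (increment N (T / real n) \<omega>) n \<notin> {\<alpha>..\<beta>}} \<le> (f y0 + T + 1) / m) sequentially"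
proof -
  interpret prob_space M using noise by (simp add: noise_def)
  \<comment> \<open>Midpoints between the barriers and the ends: clamping to \<open>[a, b]\<close>
    leaves an exited value outside \<open>[\<alpha>, \<beta>]\<close>, where \<open>big\<close>
    applies.\<close>
  define a b where "a = (\<alpha> - L) / 2" and "b = (\<beta> + L) / 2"
  have ab': "-L < a" "a < \<alpha>" "\<alpha> \<le> \<beta>" "\<beta> < b" "b < L" using ab by (auto simp: a_def b_def)
  define Z where "Z n \<omega> k = euler H \<alpha> \<beta> (T / real n) y0 (increment N (T / real n) \<omega>) k" for n \<omega> k
  have cy: "clamped f a b y0 = f y0" using ab ab' by (simp add: min_absorb2 max_absorb2)
  have "eventually (\<lambda>n. (\<integral>\<omega>. clamped f a b (Z n \<omega> n) \<partial>M)
      - (\<Sum>k<n. T / real n * measure M {\<omega> \<in> space M. Z n \<omega> k \<in> {\<alpha>..\<beta>}}) < f y0 + 1) sequentially"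
    using order_tendstoD(2)[OF euler_exit_limit[OF ab'], of "f y0 + 1"] cy by (simp add: Z_def)
  moreover have "eventually (\<lambda>n::nat. 0 < n) sequentially" by (rule eventually_gt_at_top)
  ultimately show ?thesis unfolding Z_def[symmetric]
  proof eventually_elim
    case (elim n)
    have [measurable]: "(\<lambda>\<omega>. Z n \<omega> n) \<in> borel_measurable M"
      unfolding Z_def using elim ab by (intro euler_terminal_measurable) auto
    have [measurable]: "clamped f a b \<in> borel_measurable borel" using ab' by (intro clamped_f_measurable) auto
    define A where "A = {\<omega> \<in> space M. Z n \<omega> n \<notin> {\<alpha>..\<beta>}}"
    have [measurable]: "A \<in> events" unfolding A_def by measurable
    have G: "m * indicator A \<omega> \<le> clamped f a b (Z n \<omega> n)" for \<omega>
    proof (cases "\<omega> \<in> A")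
      case True
      then have "max a (min b (Z n \<omega> n)) \<in> {-L<..<L} - {\<alpha>..\<beta>}" using ab' by (auto simp: A_def)
      then show ?thesis using big True by simp
    next
      case False
      moreover have "max a (min b (Z n \<omega> n)) \<in> {-L<..<L}" using ab' by auto
      ultimately show ?thesis using nn by simp
    qed
    obtain C where "norm (clamped f a b y) \<le> C" for y
      using clamped_f_bounded[of a b] ab' by auto
    then have int: "integrable M (\<lambda>\<omega>. clamped f a b (Z n \<omega> n))"
      by (intro integrable_const_bound[of _ C]) auto
    have "m * prob A = (\<integral>\<omega>. m * indicator A \<omega> \<partial>M)" by simp
    also have "\<dots> \<le> (\<integral>\<omega>. clamped f a b (Z n \<omega> n) \<partial>M)"
      using G int by (intro integral_mono) (auto intro!: integrable_mult_right integrable_real_indicator simp: emeasure_eq_measure)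
    also have "\<dots> < f y0 + 1 + (\<Sum>k<n. T / real n * prob {\<omega> \<in> space M. Z n \<omega> k \<in> {\<alpha>..\<beta>}})"
      using elim by simp
    also have "(\<Sum>k<n. T / real n * prob {\<omega> \<in> space M. Z n \<omega> k \<in> {\<alpha>..\<beta>}}) \<le> (\<Sum>k<n. T / real n * 1)"
      using T by (intro sum_mono mult_left_mono) auto
    also have "\<dots> = T" using elim by simp
    finally show ?case using m by (simp add: A_def field_simps)
  qed
qed

text \<open>In mean, \<open>f\<close> gains the lifetime. Chains alive at the end contribute at most
  \<open>C\<close> times their probability, and this is offset by the lifetime, as they have lived
  for \<open>T \<ge> C\<close>. Exits above contribute nothing positive, so exits below must account
  for \<open>f y0\<close>, half of which is given up to the discretization error. The bound does not
  involve \<open>\<alpha>\<close>.\<close>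

lemma euler_exit_below_prob_ge:
  assumes pos: "0 < f y0" and C: "\<And>y. y \<in> {-L<..b} \<Longrightarrow> f y \<le> C" and neg: "\<And>y. y \<in> {\<beta>..b} \<Longrightarrow> f y \<le> 0"
    and ab: "-L < \<alpha>" "\<alpha> \<le> y0" "y0 < \<beta>" "\<beta> < b" "b < L" and TC: "C \<le> T"
  shows "eventually (\<lambda>n. f y0 / (2 * C) \<le> measure M {\<omega> \<in> space M.
      euler H \<alpha> \<beta> (T / real n) y0 (increment N (T / real n) \<omega>) n < \<alpha>}) sequentially"
proof -
  interpret prob_space M using noise by (simp add: noise_def)
  define a where "a = (\<alpha> - L) / 2"
  have ab': "-L < a" "a < \<alpha>" "\<alpha> \<le> \<beta>" "\<beta> < b" "b < L" using ab by (auto simp: a_def)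
  define Z where "Z n \<omega> k = euler H \<alpha> \<beta> (T / real n) y0 (increment N (T / real n) \<omega>) k" for n \<omega> k
  have cy: "clamped f a b y0 = f y0" using ab ab' by (simp add: min_absorb2 max_absorb2)
  have C0: "0 < C" using pos C[of y0] ab by auto
  have "eventually (\<lambda>n. f y0 / 2 < (\<integral>\<omega>. clamped f a b (Z n \<omega> n) \<partial>M)
      - (\<Sum>k<n. T / real n * measure M {\<omega> \<in> space M. Z n \<omega> k \<in> {\<alpha>..\<beta>}})) sequentially"
    using order_tendstoD(1)[OF euler_exit_limit[OF ab'], of "f y0 / 2"] cy pos by (simp add: Z_def)
  moreover have "eventually (\<lambda>n::nat. 0 < n) sequentially" by (rule eventually_gt_at_top)
  ultimately show ?thesis unfolding Z_def[symmetric]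
  proof eventually_elim
    case (elim n)
    have [measurable]: "(\<lambda>\<omega>. Z n \<omega> k) \<in> borel_measurable M" for k
      unfolding Z_def using elim ab by (intro euler_terminal_measurable) auto
    have [measurable]: "clamped f a b \<in> borel_measurable borel" using ab' by (intro clamped_f_measurable) auto
    define A where "A = {\<omega> \<in> space M. Z n \<omega> n \<in> {\<alpha>..\<beta>}}"
    define B where "B = {\<omega> \<in> space M. Z n \<omega> n < \<alpha>}"
    have [measurable]: "A \<in> events" "B \<in> events" unfolding A_def B_def by measurable
    have G: "clamped f a b (Z n \<omega> n) \<le> C * indicator A \<omega> + C * indicator B \<omega>" if \<omega>: "\<omega> \<in> space M" for \<omega>
    proof (cases "Z n \<omega> n \<le> \<beta>")
      case True
      then have "1 \<le> indicator A \<omega> + (indicator B \<omega> :: real)" using \<omega> by (auto simp: A_def B_def indicator_def)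
      then have "C * 1 \<le> C * (indicator A \<omega> + indicator B \<omega>)" using C0 by (intro mult_left_mono) auto
      moreover have "clamped f a b (Z n \<omega> n) \<le> C" by (rule C) (use ab' in auto)
      ultimately show ?thesis by (simp add: algebra_simps)
    next
      case False
      then have "clamped f a b (Z n \<omega> n) \<le> 0" by (intro neg) (use ab' in auto)
      also have "0 \<le> C * indicator A \<omega> + C * indicator B \<omega>"
        using C0 by (intro add_nonneg_nonneg mult_nonneg_nonneg) auto
      finally show ?thesis .
    qed
    obtain K where "norm (clamped f a b y) \<le> K" for y
      using clamped_f_bounded[of a b] ab' by auto
    then have int: "integrable M (\<lambda>\<omega>. clamped f a b (Z n \<omega> n))"
      by (intro integrable_const_bound[of _ K]) auto
    have intAB: "integrable M (\<lambda>\<omega>. C * indicator A \<omega> + C * indicator B \<omega> :: real)"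
      by (intro Bochner_Integration.integrable_add integrable_mult_right integrable_real_indicator) (auto simp: emeasure_eq_measure)
    have "(\<integral>\<omega>. clamped f a b (Z n \<omega> n) \<partial>M) \<le> (\<integral>\<omega>. C * indicator A \<omega> + C * indicator B \<omega> \<partial>M)"
      using G int intAB by (intro integral_mono) auto
    also have "\<dots> = C * prob A + C * prob B"
      by (subst Bochner_Integration.integral_add) (auto intro!: integrable_mult_right integrable_real_indicator simp: emeasure_eq_measure)
    finally have EG: "(\<integral>\<omega>. clamped f a b (Z n \<omega> n) \<partial>M) \<le> C * prob A + C * prob B" .
    have "C * prob A \<le> T * prob A" using TC by (intro mult_right_mono) auto
    also have "\<dots> = (\<Sum>k<n. T / real n * prob A)" using elim by simp
    \<comment> \<open>By freezing, a chain inside the interval at step \<open>n\<close> was inside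
      at every earlier step.\<close>
    also have "\<dots> \<le> (\<Sum>k<n. T / real n * prob {\<omega> \<in> space M. Z n \<omega> k \<in> {\<alpha>..\<beta>}})"
    proof (intro sum_mono mult_left_mono finite_measure_mono)
      fix k assume "k \<in> {..<n}"
      then have "k \<le> n" by simp
      from euler_frozen[OF this] show "A \<subseteq> {\<omega> \<in> space M. Z n \<omega> k \<in> {\<alpha>..\<beta>}}"
        unfolding A_def Z_def by (smt (verit, del_insts) mem_Collect_eq subsetI)
    qed (use T in auto)
    finally have "f y0 / 2 < C * prob B" using elim EG by linarith
    then show ?case using C0 by (simp add: B_def field_simps)
  qed
qed

end

section \<open>Explosion and survival of the log-ratio\<close>

text \<open>A purely pathwise notion, closed under reflection of \<open>Y\<close> and
  \<open>N\<close> for odd \<open>h\<close>. The behaviour of the path near a finite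
  \<open>\<tau>\<close> is treated at the level of the market.\<close>

definition logit_solution :: "'a measure \<Rightarrow> real \<Rightarrow> (real \<Rightarrow> real) \<Rightarrow> real \<Rightarrow> (real \<Rightarrow> 'a \<Rightarrow> real) \<Rightarrow>
    (real \<Rightarrow> 'a \<Rightarrow> real) \<Rightarrow> ('a \<Rightarrow> ereal) \<Rightarrow> bool" where
  "logit_solution M L h y0 N Y \<tau> \<longleftrightarrow> (AE \<omega> in M. N 0 \<omega> = 0 \<and> continuous_on {0..} (\<lambda>t. N t \<omega>)
    \<and> continuous_on {t. 0 \<le> t \<and> ereal t < \<tau> \<omega>} (\<lambda>t. Y t \<omega>)
    \<and> (\<forall>t. 0 \<le> t \<longrightarrow> ereal t < \<tau> \<omega> \<longrightarrow> Y t \<omega> \<in> {-L<..<L}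
        \<and> Y t \<omega> = y0 - integral {0..t} (\<lambda>s. h (Y s \<omega>)) + N t \<omega>))"

lemma logit_solution_uminus:
  assumes sol: "logit_solution M L h y0 N Y \<tau>" and h: "\<And>y. h (- y) = - h y"
  shows "logit_solution M L h (- y0) (\<lambda>t \<omega>. - N t \<omega>) (\<lambda>t \<omega>. - Y t \<omega>) \<tau>"
  using sol unfolding logit_solution_def
  by (elim AE_mp) (auto intro!: AE_I2 continuous_intros simp: h)

text \<open>For almost every path there is a level \<open>r\<close> such that arbitrarily fine
  meshes have a chain confined to \<open>[- \<beta> r, \<beta> r]\<close> up to time
  \<open>T\<close>. One of them is fine enough for the comparison, which keeps \<open>Y\<close>
  below \<open>\<beta> r + \<rho> < L\<close>.\<close>

lemma nonexplosion_upper: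
  fixes f u h :: "real \<Rightarrow> real"
  assumes noise: "noise M N" and sol: "logit_solution M L h y0 N Y \<tau>" and T: "0 < T"
    and h: "continuous_on {-L<..<L} h" and y0: "y0 \<in> {-L<..<L}"
    and f: "\<And>y. y \<in> {-L<..<L} \<Longrightarrow> (f has_real_derivative u y) (at y)"
    and u: "\<And>y. y \<in> {-L<..<L} \<Longrightarrow> (u has_real_derivative 1 + (h y - 1) * u y) (at y)"
    and nn: "\<And>y. y \<in> {-L<..<L} \<Longrightarrow> 0 \<le> f y"
    and unb: "\<And>m. \<exists>\<beta>\<in>{0<..<L}. \<forall>y\<in>{-L<..<L}. \<beta> \<le> \<bar>y\<bar> \<longrightarrow> m \<le> f y"
  shows "AE \<omega> in M. \<exists>b<L. \<forall>t. 0 \<le> t \<and> t \<le> T \<and> ereal t < \<tau> \<omega> \<longrightarrow> Y t \<omega> \<le> b"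
proof -
  interpret prob_space M using noise by (simp add: noise_def)
  \<comment> \<open>The numerator of the exit bound: the level \<open>m = c * real (Suc r)\<close>
    makes it exactly \<open>1 / real (Suc r)\<close>.\<close>
  define c where "c = f y0 + T + 1"
  have c: "0 < c" using nn[OF y0] T by (simp add: c_def)
  have "\<exists>\<beta><L. \<bar>y0\<bar> \<le> \<beta> \<and> 0 < \<beta> \<and> (\<forall>y\<in>{-L<..<L} - {- \<beta>..\<beta>}. c * real (Suc r) \<le> f y)" for r
  proof -
    obtain \<beta> where \<beta>: "\<beta> \<in> {0<..<L}" "\<forall>y\<in>{-L<..<L}. \<beta> \<le> \<bar>y\<bar> \<longrightarrow> c * real (Suc r) \<le> f y" using unb by blast
    show ?thesis
    proof (intro exI[of _ "max \<beta> \<bar>y0\<bar>"] conjI ballI)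
      show "max \<beta> \<bar>y0\<bar> < L" "0 < max \<beta> \<bar>y0\<bar>" using \<beta>(1) y0 by (auto simp: abs_less_iff)
      fix y assume y: "y \<in> {-L<..<L} - {- max \<beta> \<bar>y0\<bar>..max \<beta> \<bar>y0\<bar>}"
      then have "\<beta> \<le> \<bar>y\<bar>" by (auto simp: abs_if)
      then show "c * real (Suc r) \<le> f y" using \<beta>(2) y by blast
    qed auto
  qed
  then obtain \<beta> where \<beta>: "\<And>r. \<beta> r < L" "\<And>r. \<bar>y0\<bar> \<le> \<beta> r" "\<And>r. 0 < \<beta> r"
    "\<And>r y. y \<in> {-L<..<L} - {- \<beta> r..\<beta> r} \<Longrightarrow> c * real (Suc r) \<le> f y" by metis
  have H: "continuous_on {-L<..<L} (\<lambda>y. h y - 1)" using h by (intro continuous_intros)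
  have L: "- L < - \<beta> r" "- \<beta> r \<le> y0" "y0 \<le> \<beta> r" for r using \<beta>(1)[of r] \<beta>(2)[of r] by (auto simp: abs_le_iff)
  define Z where "Z r n \<omega> k = euler (\<lambda>y. h y - 1) (- \<beta> r) (\<beta> r) (T / real n) y0 (increment N (T / real n) \<omega>) k"
    for r n \<omega> k
  \<comment> \<open>\<open>Suc n\<close> keeps the number of steps positive, so that
    \<open>B r n\<close> is an event for every index.\<close>
  define B where "B r n = {\<omega> \<in> space M. Z r (Suc n) \<omega> (Suc n) \<notin> {- \<beta> r..\<beta> r}}" for r n
  have "B r n \<in> events" for r n
  proof -
    have [measurable]: "(\<lambda>\<omega>. Z r (Suc n) \<omega> (Suc n)) \<in> borel_measurable M"
      unfolding Z_def by (rule euler_terminal_measurable[OF noise T H f u L(1) \<beta>(1)]) auto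
    show ?thesis unfolding B_def by measurable
  qed
  moreover have "eventually (\<lambda>n. prob (B r n) \<le> 1 / real (Suc r)) sequentially" for r
  proof -
    have m0: "0 < c * real (Suc r)" using c by simp
    have "eventually (\<lambda>n. prob {\<omega> \<in> space M. Z r n \<omega> n \<notin> {- \<beta> r..\<beta> r}} \<le> (f y0 + T + 1) / (c * real (Suc r))) sequentially"
      unfolding Z_def by (rule euler_exit_prob_le[OF noise T H f u nn m0 \<beta>(4) L \<beta>(1)])
    moreover have "(f y0 + T + 1) / (c * real (Suc r)) = 1 / real (Suc r)"
      using c unfolding c_def[symmetric] by simp
    ultimately have "eventually (\<lambda>n. prob {\<omega> \<in> space M. Z r n \<omega> n \<notin> {- \<beta> r..\<beta> r}} \<le> 1 / real (Suc r)) sequentially"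
      by (simp only:)
    then show ?thesis unfolding B_def by (subst (asm) eventually_sequentially_Suc[symmetric])
  qed
  ultimately have "AE \<omega> in M. \<exists>r. \<forall>n. \<exists>k\<ge>n. \<omega> \<notin> B r k" by (rule AE_frequently_notin)
  with sol[unfolded logit_solution_def] AE_space show ?thesis
  proof eventually_elim
    case (elim \<omega>)
    then obtain r where r: "\<And>n. \<exists>k\<ge>n. \<omega> \<notin> B r k" by blast
    define \<rho> where "\<rho> = (L - \<beta> r) / 2"
    have \<rho>: "0 < \<rho>" "- L < - \<beta> r - \<rho>" "\<beta> r + \<rho> < L" using \<beta>(1)[of r] by (auto simp: \<rho>_def field_simps)
    have "\<exists>n0. \<forall>n\<ge>n0. \<forall>k\<le>n. (\<forall>j<k. Z r n \<omega> j \<in> {- \<beta> r..\<beta> r}) \<longrightarrow>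
        (ereal (real k * (T / real n)) < \<tau> \<omega> \<longrightarrow> Y (real k * (T / real n)) \<omega> \<le> Z r n \<omega> k) \<and>
        (\<forall>t. 0 \<le> t \<and> t \<le> real k * (T / real n) \<and> ereal t < \<tau> \<omega> \<longrightarrow> Y t \<omega> \<le> \<beta> r + \<rho>)"
      unfolding Z_def
      by (rule euler_comparison[where N = "\<lambda>t. N t \<omega>" and Y = "\<lambda>t. Y t \<omega>" and h = h, OF _ _ h _ _ _ \<rho> L(3) _ T])
        (use elim in auto)
    then obtain n0 where n0: "\<And>n k t. n0 \<le> n \<Longrightarrow> k \<le> n \<Longrightarrow> (\<forall>j<k. Z r n \<omega> j \<in> {- \<beta> r..\<beta> r}) \<Longrightarrow>
        0 \<le> t \<and> t \<le> real k * (T / real n) \<and> ereal t < \<tau> \<omega> \<Longrightarrow> Y t \<omega> \<le> \<beta> r + \<rho>" by blast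
    obtain k where k: "n0 \<le> k" "\<omega> \<notin> B r k" using r by blast
    define n where "n = Suc k"
    have Zn: "Z r n \<omega> n \<in> {- \<beta> r..\<beta> r}" using k elim by (auto simp: B_def n_def)
    have "Z r n \<omega> j \<in> {- \<beta> r..\<beta> r}" if "j < n" for j
    proof (rule ccontr)
      assume "Z r n \<omega> j \<notin> {- \<beta> r..\<beta> r}"
      with euler_frozen[of j n] that have "Z r n \<omega> n = Z r n \<omega> j" unfolding Z_def by simp
      with Zn \<open>Z r n \<omega> j \<notin> _\<close> show False by simp
    qed
    then have "Y t \<omega> \<le> \<beta> r + \<rho>" if "0 \<le> t \<and> t \<le> T \<and> ereal t < \<tau> \<omega>" for t
      using n0[of n n t] k that by (simp add: n_def)
    then show ?case using \<rho>(3) by blast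
  qed
qed

text \<open>A surviving path has a minimum above \<open>-L\<close> on the compact interval
  \<open>[0, C]\<close>. Yet for every \<open>\<alpha> r\<close> near \<open>-L\<close> the chains,
  and \<open>Y\<close> with them, fall below \<open>\<alpha> r\<close> before time \<open>C\<close>
  with a probability bounded below independently of \<open>r\<close>.\<close>

lemma explosion:
  fixes f u h :: "real \<Rightarrow> real"
  assumes noise: "noise M N" and sol: "logit_solution M L h y0 N Y \<tau>"
    and h: "continuous_on {-L<..<L} h" and y0: "-L < y0"
    and f: "\<And>y. y \<in> {-L<..<L} \<Longrightarrow> (f has_real_derivative u y) (at y)"
    and u: "\<And>y. y \<in> {-L<..<L} \<Longrightarrow> (u has_real_derivative 1 + (h y - 1) * u y) (at y)"
    and b: "y0 < \<beta>" "\<beta> < b" "b < L"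
    and pos: "0 < f y0" and C: "\<And>y. y \<in> {-L<..b} \<Longrightarrow> f y \<le> C" and neg: "\<And>y. y \<in> {\<beta>..b} \<Longrightarrow> f y \<le> 0"
  shows "\<not> (AE \<omega> in M. \<forall>t\<ge>0. ereal t < \<tau> \<omega>)"
proof
  assume life: "AE \<omega> in M. \<forall>t\<ge>0. ereal t < \<tau> \<omega>"
  interpret prob_space M using noise by (simp add: noise_def)
  have T: "0 < C" using pos C[of y0] y0 b by auto
  have H: "continuous_on {-L<..<L} (\<lambda>y. h y - 1)" using h by (intro continuous_intros)
  \<comment> \<open>A sequence tending to \<open>-L\<close>; the 2 starts it at the midpoint of
    \<open>-L\<close> and \<open>y0\<close>, below \<open>y0\<close>.\<close>
  define \<alpha> where "\<alpha> r = - L + (L + y0) / real (r + 2)" for r :: nat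
  have \<alpha>: "- L < \<alpha> r" "\<alpha> r \<le> y0" for r
  proof -
    show "- L < \<alpha> r" using y0 by (simp add: \<alpha>_def)
    have "(L + y0) / real (r + 2) \<le> (L + y0) / 1" using y0 by (intro divide_left_mono) auto
    then show "\<alpha> r \<le> y0" by (simp add: \<alpha>_def)
  qed
  have \<beta>L: "\<beta> < L" using b by simp
  \<comment> \<open>The time horizon is \<open>C\<close> itself, the smallest one allowed by the
    lower bound on exits below.\<close>
  define Z where "Z r n \<omega> k = euler (\<lambda>y. h y - 1) (\<alpha> r) \<beta> (C / real n) y0 (increment N (C / real n) \<omega>) k"
    for r n \<omega> k
  define A where "A r n = {\<omega> \<in> space M. Z r (Suc n) \<omega> (Suc n) < \<alpha> r}" for r n
  have "A r n \<in> events" for r n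
  proof -
    have [measurable]: "(\<lambda>\<omega>. Z r (Suc n) \<omega> (Suc n)) \<in> borel_measurable M"
      unfolding Z_def by (rule euler_terminal_measurable[OF noise T H f u \<alpha>(1) \<beta>L]) auto
    show ?thesis unfolding A_def by measurable
  qed
  moreover have "0 < f y0 / (2 * C)" using pos T by simp
  moreover have "eventually (\<lambda>n. f y0 / (2 * C) \<le> prob (A r n)) sequentially" for r
  proof -
    have "eventually (\<lambda>n. f y0 / (2 * C) \<le> prob {\<omega> \<in> space M. Z r n \<omega> n < \<alpha> r}) sequentially"
      unfolding Z_def by (rule euler_exit_below_prob_ge[OF noise T H f u pos C neg \<alpha> b order_refl])
    then show ?thesis unfolding A_def by (subst (asm) eventually_sequentially_Suc[symmetric])
  qed
  ultimately have "\<not> (AE \<omega> in M. \<exists>r0. \<forall>r\<ge>r0. \<exists>n. \<forall>k\<ge>n. \<omega> \<notin> A r k)" by (rule not_AE_eventually_notin)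
  moreover from sol[unfolded logit_solution_def] life AE_space
  have "AE \<omega> in M. \<exists>r0. \<forall>r\<ge>r0. \<exists>n. \<forall>k\<ge>n. \<omega> \<notin> A r k"
  proof eventually_elim
    case (elim \<omega>)
    have "{t. 0 \<le> t \<and> ereal t < \<tau> \<omega>} = {0..}" using elim by auto
    then have "continuous_on {0..C} (\<lambda>t. Y t \<omega>)"
      using elim by (auto intro: continuous_on_subset)
    then obtain s where s: "s \<in> {0..C}" "\<And>t. t \<in> {0..C} \<Longrightarrow> Y s \<omega> \<le> Y t \<omega>"
      using continuous_attains_inf[of "{0..C}" "\<lambda>t. Y t \<omega>"] T by auto
    have "- L < Y s \<omega>" using elim s(1) by auto
    then obtain r0 :: nat where "(L + y0) / (Y s \<omega> + L) < real r0" using reals_Archimedean2 by blast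
    then have r0: "L + y0 < (Y s \<omega> + L) * real r0" using \<open>- L < Y s \<omega>\<close> by (simp add: field_simps)
    have "\<exists>n. \<forall>k\<ge>n. \<omega> \<notin> A r k" if "r0 \<le> r" for r
    proof -
      have "(Y s \<omega> + L) * real r0 \<le> (Y s \<omega> + L) * real (r + 2)"
        using \<open>- L < Y s \<omega>\<close> that by (intro mult_left_mono) auto
      then have "(L + y0) / real (r + 2) < Y s \<omega> + L" using r0 by (simp add: divide_less_eq)
      then have \<alpha>Y: "\<alpha> r < Y s \<omega>" by (simp add: \<alpha>_def)
      define \<rho> where "\<rho> = min (L - \<beta>) (\<alpha> r + L) / 2"
      have \<rho>: "0 < \<rho>" "- L < \<alpha> r - \<rho>" "\<beta> + \<rho> < L"
        using \<alpha>(1)[of r] \<beta>L by (auto simp: \<rho>_def min_def field_simps)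
      have "\<exists>n0. \<forall>n\<ge>n0. \<forall>k\<le>n. (\<forall>j<k. Z r n \<omega> j \<in> {\<alpha> r..\<beta>}) \<longrightarrow>
          (ereal (real k * (C / real n)) < \<tau> \<omega> \<longrightarrow> Y (real k * (C / real n)) \<omega> \<le> Z r n \<omega> k) \<and>
          (\<forall>t. 0 \<le> t \<and> t \<le> real k * (C / real n) \<and> ereal t < \<tau> \<omega> \<longrightarrow> Y t \<omega> \<le> \<beta> + \<rho>)"
        unfolding Z_def
        by (rule euler_comparison[where N = "\<lambda>t. N t \<omega>" and Y = "\<lambda>t. Y t \<omega>" and h = h, OF _ _ h _ _ _ \<rho> less_imp_le[OF b(1)] _ T])
          (use elim in auto)
      then obtain n0 where n0: "\<And>n k. n0 \<le> n \<Longrightarrow> k \<le> n \<Longrightarrow> (\<forall>j<k. Z r n \<omega> j \<in> {\<alpha> r..\<beta>}) \<Longrightarrow>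
          ereal (real k * (C / real n)) < \<tau> \<omega> \<Longrightarrow> Y (real k * (C / real n)) \<omega> \<le> Z r n \<omega> k" by blast
      have "\<omega> \<notin> A r k" if k: "n0 \<le> k" for k
      proof
        assume "\<omega> \<in> A r k"
        define n where "n = Suc k"
        have Zn: "Z r n \<omega> n < \<alpha> r" using \<open>\<omega> \<in> A r k\<close> by (simp add: A_def n_def)
        \<comment> \<open>The comparison is valid up to and including the first exit
          \<open>j\<close>; afterwards the chain is frozen, so its value at \<open>j\<close> is the
          terminal one, below \<open>\<alpha> r\<close> and hence below the minimum of
          \<open>Y\<close>.\<close>
        define j where "j = (LEAST j. Z r n \<omega> j \<notin> {\<alpha> r..\<beta>})"
        have ex: "Z r n \<omega> n \<notin> {\<alpha> r..\<beta>}" using Zn by simp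
        have j: "Z r n \<omega> j \<notin> {\<alpha> r..\<beta>}" "j \<le> n" and before: "\<forall>i<j. Z r n \<omega> i \<in> {\<alpha> r..\<beta>}"
          unfolding j_def using LeastI[of "\<lambda>j. Z r n \<omega> j \<notin> {\<alpha> r..\<beta>}", OF ex]
            Least_le[of "\<lambda>j. Z r n \<omega> j \<notin> {\<alpha> r..\<beta>}", OF ex] not_less_Least by blast+
        have "Z r n \<omega> n = Z r n \<omega> j" unfolding Z_def using j by (intro euler_frozen) (auto simp: Z_def)
        moreover have "0 \<le> real j * (C / real n)" using T by simp
        moreover have "real j * (C / real n) \<le> real n * (C / real n)"
          using j(2) T by (intro mult_right_mono) auto
        moreover have "real n * (C / real n) = C" by (simp add: n_def)
        ultimately show False
          using n0[of n j] k j(2) before elim s(2)[of "real j * (C / real n)"] Zn \<alpha>Y by (force simp: n_def)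
      qed
      then show ?thesis by blast
    qed
    then show ?case by blast
  qed
  ultimately show False by blast
qed

section \<open>The market model\<close>

lemma logistic_ln_diff:
  assumes "0 < a" "0 < b"
  shows "logistic (ln a - ln b) = a / (a + b)"
  using assms by (simp add: logistic_def exp_diff field_simps)

lemma continuous_on_logit_drift:
  assumes \<delta>: "0 < \<delta>" "\<delta> < 1 / 2" and g: "continuous_on {0<..<1 - \<delta>} g"
  shows "continuous_on {- ln ((1 - \<delta>) / \<delta>)<..<ln ((1 - \<delta>) / \<delta>)} (logit_drift g)"
proof -
  define L where "L = ln ((1 - \<delta>) / \<delta>)"
  have "logistic L = 1 - \<delta>" using logistic_logit[of "1 - \<delta>"] \<delta> by (simp add: L_def)
  then have r: "logistic y \<in> {0<..<1 - \<delta>}" if "y < L" for y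
    using that logistic_less_iff[of y L] logistic_pos[of y] by auto
  have l: "continuous_on A logistic" for A
    using DERIV_logistic by (blast intro: continuous_at_imp_continuous_on DERIV_isCont)
  have "continuous_on {-L<..<L} (\<lambda>y. g (logistic y) - g (logistic (- y)))"
    by (intro continuous_intros continuous_on_compose2[OF g] continuous_on_compose2[OF l[of UNIV]])
      (use r in auto)
  then show ?thesis unfolding L_def logit_drift_def[abs_def] .
qed

lemma market_logit_solution:
  fixes \<delta> :: real
  assumes \<delta>: "0 < \<delta>" "\<delta> < 1 / 2" and g: "continuous_on {0<..<1 - \<delta>} g"
    and BM: "std_BM2 M W" and sol: "market_solution M \<delta> g W x0 X \<tau>"
  shows "logit_solution M (ln ((1 - \<delta>) / \<delta>)) (logit_drift g) (ln (x0 1) - ln (x0 2))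
    (\<lambda>t \<omega>. W 1 t \<omega> - W 2 t \<omega>) (\<lambda>t \<omega>. ln (X 1 t \<omega>) - ln (X 2 t \<omega>)) \<tau>"
proof -
  define L where "L = ln ((1 - \<delta>) / \<delta>)"
  have logistic_L: "logistic L = 1 - \<delta>" using logistic_logit[of "1 - \<delta>"] \<delta> by (simp add: L_def)
  have "AE \<omega> in M. \<forall>i\<in>{1,2}. W i 0 \<omega> = 0 \<and> continuous_on {0..} (\<lambda>t. W i t \<omega>)"
    using BM by (simp only: std_BM2_def)
  with sol[unfolded market_solution_def] show ?thesis
    unfolding logit_solution_def L_def[symmetric]
  proof eventually_elim
    case (elim \<omega>)
    define I where "I = {t. 0 \<le> t \<and> ereal t < \<tau> \<omega>}"
    have pos: "0 < X 1 t \<omega>" "0 < X 2 t \<omega>" and dom: "mu X 1 t \<omega> < 1 - \<delta>" "mu X 2 t \<omega> < 1 - \<delta>" if "t \<in> I" for t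
      using elim that by (auto simp: I_def market_domain_def mu_def)
    have Xc: "continuous_on I (\<lambda>t. X 1 t \<omega>)" "continuous_on I (\<lambda>t. X 2 t \<omega>)"
      using elim by (auto simp: I_def)
    have ne: "X 1 t \<omega> \<noteq> 0" "X 2 t \<omega> \<noteq> 0" "X 1 t \<omega> + X 2 t \<omega> \<noteq> 0" if "t \<in> I" for t
      using pos[OF that] by auto
    have Yc: "continuous_on I (\<lambda>t. ln (X 1 t \<omega>) - ln (X 2 t \<omega>))"
      using ne by (intro continuous_intros Xc) auto
    have muc: "continuous_on I (\<lambda>t. mu X 1 t \<omega>)" "continuous_on I (\<lambda>t. mu X 2 t \<omega>)"
      unfolding mu_def by (intro continuous_intros Xc; use ne in auto)+
    have mu: "mu X 1 t \<omega> = logistic (ln (X 1 t \<omega>) - ln (X 2 t \<omega>))"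
        "mu X 2 t \<omega> = logistic (- (ln (X 1 t \<omega>) - ln (X 2 t \<omega>)))" if "t \<in> I" for t
      using logistic_ln_diff[OF pos(1)[OF that] pos(2)[OF that]] logistic_ln_diff[OF pos(2)[OF that] pos(1)[OF that]]
      by (auto simp: mu_def add.commute)
    have mupos: "mu X 1 t \<omega> \<in> {0<..<1 - \<delta>}" "mu X 2 t \<omega> \<in> {0<..<1 - \<delta>}" if "t \<in> I" for t
      using dom[OF that] mu[OF that] logistic_pos by auto
    have Yin: "ln (X 1 t \<omega>) - ln (X 2 t \<omega>) \<in> {-L<..<L}" if "t \<in> I" for t
    proof -
      have "logistic (ln (X 1 t \<omega>) - ln (X 2 t \<omega>)) < logistic L"
        "logistic (- (ln (X 1 t \<omega>) - ln (X 2 t \<omega>))) < logistic L"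
        unfolding logistic_L mu[OF that, symmetric] using dom[OF that] by auto
      then show ?thesis unfolding logistic_less_iff by auto
    qed
    have "ln (X 1 t \<omega>) - ln (X 2 t \<omega>) = ln (x0 1) - ln (x0 2)
        - integral {0..t} (\<lambda>s. logit_drift g (ln (X 1 s \<omega>) - ln (X 2 s \<omega>))) + (W 1 t \<omega> - W 2 t \<omega>)"
      if "t \<in> I" for t
    proof -
      have sub: "{0..t} \<subseteq> I" using that by (auto simp: I_def intro: le_less_trans[of _ "ereal t"])
      have "continuous_on {0..t} (\<lambda>s. g (mu X 1 s \<omega>))" "continuous_on {0..t} (\<lambda>s. g (mu X 2 s \<omega>))"
        by (rule continuous_on_compose2[OF g continuous_on_subset[OF muc(1) sub]],
            rule image_subsetI, use sub mupos(1) in blast,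
          rule continuous_on_compose2[OF g continuous_on_subset[OF muc(2) sub]],
            rule image_subsetI, use sub mupos(2) in blast)
      note int = this[THEN integrable_continuous_interval]
      have "integral {0..t} (\<lambda>s. logit_drift g (ln (X 1 s \<omega>) - ln (X 2 s \<omega>)))
          = integral {0..t} (\<lambda>s. g (mu X 1 s \<omega>) - g (mu X 2 s \<omega>))"
        using sub mu by (intro integral_cong) (auto simp: logit_drift_def)
      also have "\<dots> = integral {0..t} (\<lambda>s. g (mu X 1 s \<omega>)) - integral {0..t} (\<lambda>s. g (mu X 2 s \<omega>))"
        by (rule integral_diff[OF int])
      finally show ?thesis using elim that by (simp add: I_def)
    qed
    then show ?case using elim Yc Yin unfolding I_def by (auto intro!: continuous_intros)
  qed
qed

text \<open>In logarithmic coordinates the domain is the open strip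
  \<open>\<bar>l1 - l2\<bar> < L\<close>, so a box cut with a narrower closed strip is compact in
  it; \<open>K\<close> is the exponential image.\<close>

lemma compact_market_set:
  assumes \<delta>: "0 < \<delta>" "\<delta> < 1 / 2" and b: "b < ln ((1 - \<delta>) / \<delta>)"
  shows "\<exists>K. compact K \<and> K \<subseteq> market_domain \<delta> \<and>
    (\<forall>x y. 0 < x \<longrightarrow> 0 < y \<longrightarrow> \<bar>ln x\<bar> \<le> R \<longrightarrow> \<bar>ln y\<bar> \<le> R \<longrightarrow> \<bar>ln x - ln y\<bar> \<le> b \<longrightarrow> (x, y) \<in> K)"
proof -
  define L where "L = ln ((1 - \<delta>) / \<delta>)"
  have logistic_L: "logistic L = 1 - \<delta>" using logistic_logit[of "1 - \<delta>"] \<delta> by (simp add: L_def)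
  define C where "C = ({- R..R} \<times> {- R..R}) \<inter> {l :: real \<times> real. \<bar>fst l - snd l\<bar> \<le> b}"
  have C: "compact C" unfolding C_def
    by (intro compact_Int_closed compact_Times compact_Icc closed_Collect_le continuous_intros)
  define K where "K = (\<lambda>l. (exp (fst l), exp (snd l))) ` C"
  have "compact K" unfolding K_def by (intro compact_continuous_image C continuous_intros)
  moreover have "K \<subseteq> market_domain \<delta>"
  proof
    fix p assume "p \<in> K"
    then obtain l1 l2 where p: "p = (exp l1, exp l2)" "\<bar>l1 - l2\<bar> \<le> b" by (auto simp: K_def C_def)
    then have "logistic (l1 - l2) < logistic L" "logistic (l2 - l1) < logistic L"
      using b by (auto simp: logistic_less_iff L_def)
    then show "p \<in> market_domain \<delta>"
      using logistic_ln_diff[of "exp l1" "exp l2"] logistic_ln_diff[of "exp l2" "exp l1"]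
      by (simp add: p(1) market_domain_def logistic_L add.commute)
  qed
  moreover have "(x, y) \<in> K" if "0 < x" "0 < y" "\<bar>ln x\<bar> \<le> R" "\<bar>ln y\<bar> \<le> R" "\<bar>ln x - ln y\<bar> \<le> b" for x y
    unfolding K_def using that by (intro image_eqI[of _ _ "(ln x, ln y)"]) (auto simp: C_def)
  ultimately show ?thesis by blast
qed

text \<open>A finite lifetime forces the path out of every compact set; this can only happen in the logit coordinate,
  since bounded weights keep the drift of \<open>ln X\<close> bounded.\<close>
lemma market_survives:
  fixes W X :: "nat \<Rightarrow> real \<Rightarrow> 'a \<Rightarrow> real" and \<tau> :: "'a \<Rightarrow> ereal"
  assumes \<delta>: "0 < \<delta>" "\<delta> < 1 / 2" and g: "continuous_on {0<..<1 - \<delta>} g"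
    and BM: "std_BM2 M W" and sol: "market_solution M \<delta> g W x0 X \<tau>"
    and upper: "\<And>T. 0 < T \<Longrightarrow> AE \<omega> in M. \<exists>b<ln ((1 - \<delta>) / \<delta>).
      \<forall>t. 0 \<le> t \<and> t \<le> T \<and> ereal t < \<tau> \<omega> \<longrightarrow> ln (X 1 t \<omega>) - ln (X 2 t \<omega>) \<le> b"
    and lower: "\<And>T. 0 < T \<Longrightarrow> AE \<omega> in M. \<exists>b<ln ((1 - \<delta>) / \<delta>).
      \<forall>t. 0 \<le> t \<and> t \<le> T \<and> ereal t < \<tau> \<omega> \<longrightarrow> - (ln (X 1 t \<omega>) - ln (X 2 t \<omega>)) \<le> b"
  shows "AE \<omega> in M. \<tau> \<omega> = \<infinity>"
proof -
  define L where "L = ln ((1 - \<delta>) / \<delta>)"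
  have logistic_L: "logistic L = 1 - \<delta>" using logistic_logit[of "1 - \<delta>"] \<delta> by (simp add: L_def)
  define Y where "Y t \<omega> = ln (X 1 t \<omega>) - ln (X 2 t \<omega>)" for t \<omega>
  \<comment> \<open>Integer horizons: countably many null sets combine into one that serves the
    path-dependent \<open>\<tau>\<close>.\<close>
  have "AE \<omega> in M. \<forall>T::nat. \<exists>b<L. \<forall>t. 0 \<le> t \<and> t \<le> real (Suc T) \<and> ereal t < \<tau> \<omega> \<longrightarrow> Y t \<omega> \<le> b"
    using upper unfolding AE_all_countable Y_def L_def by simp
  moreover have "AE \<omega> in M. \<forall>T::nat. \<exists>b<L. \<forall>t. 0 \<le> t \<and> t \<le> real (Suc T) \<and> ereal t < \<tau> \<omega> \<longrightarrow> - Y t \<omega> \<le> b"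
    using lower unfolding AE_all_countable Y_def L_def by simp
  moreover have "AE \<omega> in M. \<forall>i\<in>{1,2}. W i 0 \<omega> = 0 \<and> continuous_on {0..} (\<lambda>t. W i t \<omega>)"
    using BM by (simp only: std_BM2_def)
  ultimately show ?thesis using sol[unfolded market_solution_def]
  proof eventually_elim
    case (elim \<omega>)
    show ?case
    proof (rule ccontr)
      assume "\<tau> \<omega> \<noteq> \<infinity>"
      then have fin: "\<tau> \<omega> < \<infinity>" by simp
      then obtain T0 :: nat where T0: "\<tau> \<omega> < ereal (real T0)"
        using less_PInf_Ex_of_nat[of "\<tau> \<omega>"] by auto
      define T where "T = real (Suc T0)"
      have tT: "t \<le> T" if "ereal t < \<tau> \<omega>" for t
      proof -
        have "ereal t < ereal (real T0)" using that T0 by (rule less_trans)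
        then show ?thesis by (simp add: T_def)
      qed
      obtain b1 where b1: "b1 < L" "\<And>t. 0 \<le> t \<Longrightarrow> ereal t < \<tau> \<omega> \<Longrightarrow> Y t \<omega> \<le> b1"
        using elim(1) tT unfolding T_def by (metis (no_types))
      obtain b2 where b2: "b2 < L" "\<And>t. 0 \<le> t \<Longrightarrow> ereal t < \<tau> \<omega> \<Longrightarrow> - Y t \<omega> \<le> b2"
        using elim(2) tT unfolding T_def by (metis (no_types))
      define b where "b = max b1 b2"
      have b: "b < L" and Yb: "\<bar>Y t \<omega>\<bar> \<le> b" if "0 \<le> t" "ereal t < \<tau> \<omega>" for t
        using b1 b2(1) b1(2)[OF that] b2(2)[OF that] by (auto simp: b_def)
      have \<tau>0: "0 < \<tau> \<omega>" using elim(4) by (elim conjE)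
      have XD: "(X 1 t \<omega>, X 2 t \<omega>) \<in> market_domain \<delta>" if "0 \<le> t" "ereal t < \<tau> \<omega>" for t
        using elim(4) that by blast
      have XC: "continuous_on {t. 0 \<le> t \<and> ereal t < \<tau> \<omega>} (\<lambda>t. X i t \<omega>)" if "i \<in> {1, 2}" for i
        using elim(4) that by blast
      have Xeq: "ln (X i t \<omega>) = ln (x0 i) - integral {0..t} (\<lambda>s. g (mu X i s \<omega>)) + W i t \<omega>"
        if "i \<in> {1, 2}" "0 \<le> t" "ereal t < \<tau> \<omega>" for i t
        using elim(4) that by blast
      have escape: "\<exists>t. 0 \<le> t \<and> ereal t < \<tau> \<omega> \<and> (X 1 t \<omega>, X 2 t \<omega>) \<notin> K"
        if "compact K" "K \<subseteq> market_domain \<delta>" for K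
        using elim(4) fin that by blast
      have "ereal 0 < \<tau> \<omega>" using \<tau>0 by (simp add: zero_ereal_def)
      then have bL: "b < L" by (rule b[OF order_refl])
      \<comment> \<open>\<open>\<bar>Y\<bar> \<le> b\<close> confines both weights to this compact
        interval, on which \<open>g\<close> is bounded.\<close>
      have "{logistic (- b)..logistic b} \<subseteq> {0<..<1 - \<delta>}"
        using logistic_pos[of "- b"] logistic_less_iff[of b L] bL logistic_L by auto
      from continuous_on_Icc_bounded[OF continuous_on_subset[OF g this]] obtain Cg where
        Cg: "0 \<le> Cg" "\<And>m. m \<in> {logistic (- b)..logistic b} \<Longrightarrow> \<bar>g m\<bar> \<le> Cg" by blast
      have bound: "\<exists>R. \<forall>t. 0 \<le> t \<longrightarrow> ereal t < \<tau> \<omega> \<longrightarrow> \<bar>ln (X i t \<omega>)\<bar> \<le> R" if i: "i \<in> {1, 2}" for i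
      proof -
        have "continuous_on {0..T} (\<lambda>t. W i t \<omega>)"
          using elim(3) i by (auto intro: continuous_on_subset)
        from continuous_on_Icc_bounded[OF this] obtain Cw where
          Cw: "\<And>t. t \<in> {0..T} \<Longrightarrow> \<bar>W i t \<omega>\<bar> \<le> Cw" by blast
        have "\<bar>ln (X i t \<omega>)\<bar> \<le> \<bar>ln (x0 i)\<bar> + Cg * T + Cw" if t: "0 \<le> t" "ereal t < \<tau> \<omega>" for t
        proof -
          have before: "0 \<le> s \<and> ereal s < \<tau> \<omega>" if "s \<in> {0..t}" for s
            using that t(2) by (auto intro: le_less_trans[of _ "ereal t"])
          have pos: "0 < X 1 s \<omega>" "0 < X 2 s \<omega>" if "s \<in> {0..t}" for s
            using XD[of s] before[OF that] by (auto simp: market_domain_def)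
          have mu: "mu X i s \<omega> \<in> {logistic (- b)..logistic b}" if s: "s \<in> {0..t}" for s
          proof -
            have "mu X i s \<omega> = logistic (Y s \<omega>) \<or> mu X i s \<omega> = logistic (- Y s \<omega>)"
              using i logistic_ln_diff[OF pos(1)[OF s] pos(2)[OF s]] logistic_ln_diff[OF pos(2)[OF s] pos(1)[OF s]]
              by (auto simp: mu_def Y_def add.commute)
            moreover have "\<bar>Y s \<omega>\<bar> \<le> b" using Yb before[OF s] by blast
            ultimately show ?thesis by (auto simp: logistic_le_iff)
          qed
          have Xc: "continuous_on {0..t} (\<lambda>s. X j s \<omega>)" if "j \<in> {1, 2}" for j
            using before by (intro continuous_on_subset[OF XC[OF that]]) auto
          have "continuous_on {0..t} (\<lambda>s. mu X i s \<omega>)"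
            unfolding mu_def
          proof (intro continuous_on_divide continuous_on_add ballI)
            fix s assume "s \<in> {0..t}"
            from pos[OF this] show "X 1 s \<omega> + X 2 s \<omega> \<noteq> 0" by linarith
          qed (use i in \<open>auto intro!: Xc\<close>)
          then have "continuous_on {0..t} (\<lambda>s. g (mu X i s \<omega>))"
            using mu \<open>{logistic (- b)..logistic b} \<subseteq> _\<close> by (intro continuous_on_compose2[OF g]) blast+
          then have "norm (integral {0..t} (\<lambda>s. g (mu X i s \<omega>))) \<le> Cg * (t - 0)"
            using t mu Cg(2) by (intro integral_bound) auto
          also have "\<dots> \<le> Cg * T" using tT[OF t(2)] t Cg(1) by (intro mult_left_mono) auto
          finally have "\<bar>integral {0..t} (\<lambda>s. g (mu X i s \<omega>))\<bar> \<le> Cg * T" by simp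
          moreover have "\<bar>W i t \<omega>\<bar> \<le> Cw" using t tT by (intro Cw) auto
          ultimately show ?thesis using Xeq[OF i t] by linarith
        qed
        then show ?thesis by blast
      qed
      obtain R1 where R1: "\<And>t. 0 \<le> t \<Longrightarrow> ereal t < \<tau> \<omega> \<Longrightarrow> \<bar>ln (X 1 t \<omega>)\<bar> \<le> R1" using bound[of 1] by auto
      obtain R2 where R2: "\<And>t. 0 \<le> t \<Longrightarrow> ereal t < \<tau> \<omega> \<Longrightarrow> \<bar>ln (X 2 t \<omega>)\<bar> \<le> R2" using bound[of 2] by auto
      obtain K where K: "compact K" "K \<subseteq> market_domain \<delta>"
        "\<And>x y. 0 < x \<Longrightarrow> 0 < y \<Longrightarrow> \<bar>ln x\<bar> \<le> max R1 R2 \<Longrightarrow> \<bar>ln y\<bar> \<le> max R1 R2 \<Longrightarrow> \<bar>ln x - ln y\<bar> \<le> b \<Longrightarrow> (x, y) \<in> K"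
        using compact_market_set[OF \<delta> bL[unfolded L_def], of "max R1 R2"] by blast
      obtain t where t: "0 \<le> t" "ereal t < \<tau> \<omega>" "(X 1 t \<omega>, X 2 t \<omega>) \<notin> K"
        using escape[OF K(1,2)] by blast
      have "0 < X 1 t \<omega>" "0 < X 2 t \<omega>" using XD[OF t(1,2)] by (auto simp: market_domain_def)
      then have "(X 1 t \<omega>, X 2 t \<omega>) \<in> K"
        using R1[OF t(1,2)] R2[OF t(1,2)] Yb[OF t(1,2)] by (intro K(3)) (auto simp: Y_def)
      with t(3) show False by blast
    qed
  qed
qed

theorem theorem1:
  fixes M :: "'a measure" and \<delta> :: real and g :: "real \<Rightarrow> real"
    and W X :: "nat \<Rightarrow> real \<Rightarrow> 'a \<Rightarrow> real" and x0 :: "nat \<Rightarrow> real" and \<tau> :: "'a \<Rightarrow> ereal"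
  assumes "0 < \<delta>" and "\<delta> < 1/2"
    and "admissible \<delta> g"
    and "std_BM2 M W"
    and "0 < x0 1" and "0 < x0 2"
    and "\<delta> < x0 1 / (x0 1 + x0 2)" and "x0 1 / (x0 1 + x0 2) < 1 - \<delta>"
    and "market_solution M \<delta> g W x0 X \<tau>"
  shows "delta_diverse M \<delta> X \<tau> \<longleftrightarrow>
    (\<integral>\<^sup>+ y. ennreal (exp (integral {1/2..y} (\<lambda>z. A2 z * g z))) * indicator {1/2..<1 - \<delta>} y \<partial>lborel) = \<infinity>"
proof -
  define L where "L = ln ((1 - \<delta>) / \<delta>)"
  define y0 where "y0 = ln (x0 1) - ln (x0 2)"
  note \<delta> = assms(1,2) and adm = assms(3) and BM = assms(4) and sol = assms(9)
  have gc: "continuous_on {0<..<1 - \<delta>} g" using adm by (simp add: admissible_def)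
  have h: "continuous_on {-L<..<L} (logit_drift g)"
    unfolding L_def by (rule continuous_on_logit_drift[OF \<delta> gc])
  have logistic_L: "logistic L = 1 - \<delta>" using logistic_logit[of "1 - \<delta>"] \<delta> by (simp add: L_def)
  have y0': "logistic y0 = x0 1 / (x0 1 + x0 2)" using assms by (simp add: y0_def logistic_ln_diff)
  then have "logistic y0 < logistic L" "logistic (- L) < logistic y0"
    using assms(7,8) by (auto simp: logistic_L logistic_minus)
  then have y0: "y0 \<in> {-L<..<L}" by (simp add: logistic_less_iff)
  define N where "N t \<omega> = W 1 t \<omega> - W 2 t \<omega>" for t \<omega>
  define Y where "Y t \<omega> = ln (X 1 t \<omega>) - ln (X 2 t \<omega>)" for t \<omega>
  have noise: "noise M N" unfolding N_def by (rule std_BM2_noise[OF BM])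
  have lsol: "logit_solution M L (logit_drift g) y0 N Y \<tau>"
    unfolding L_def y0_def N_def Y_def by (rule market_logit_solution[OF \<delta> gc BM sol])
  show ?thesis
  proof
    assume div: "delta_diverse M \<delta> X \<tau>"
    show "(\<integral>\<^sup>+ y. ennreal (exp (integral {1/2..y} (\<lambda>z. A2 z * g z))) * indicator {1/2..<1 - \<delta>} y \<partial>lborel) = \<infinity>"
    proof (rule ccontr)
      assume "\<not> ?thesis"
      from explosion_function[OF \<delta> adm this, folded L_def, OF y0] obtain f u C \<beta> b where
        fu: "\<forall>y\<in>{-L<..<L}. (f has_real_derivative u y) (at y) \<and>
          (u has_real_derivative 1 + (logit_drift g y - 1) * u y) (at y)"
        and b: "y0 < \<beta>" "\<beta> < b" "b < L" and pos: "0 < f y0"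
        and C: "\<forall>y\<in>{-L<..b}. f y \<le> C" and neg: "\<forall>y\<in>{\<beta>..b}. f y \<le> 0"
        by (elim exE conjE) (rule that; assumption)
      have "\<not> (AE \<omega> in M. \<forall>t\<ge>0. ereal t < \<tau> \<omega>)"
        by (rule explosion[where f = f and u = u and C = C, OF noise lsol h _ _ _ b pos]) (use y0 fu C neg in auto)
      moreover have "AE \<omega> in M. \<forall>t\<ge>0. ereal t < \<tau> \<omega>"
        using div unfolding delta_diverse_def by eventually_elim blast
      ultimately show False by blast
    qed
  next
    assume inf: "(\<integral>\<^sup>+ y. ennreal (exp (integral {1/2..y} (\<lambda>z. A2 z * g z))) * indicator {1/2..<1 - \<delta>} y \<partial>lborel) = \<infinity>"
    from nonexplosion_function[OF \<delta> adm this, folded L_def] obtain f u where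
      fu: "\<forall>y\<in>{-L<..<L}. (f has_real_derivative u y) (at y) \<and>
        (u has_real_derivative 1 + (logit_drift g y - 1) * u y) (at y) \<and> 0 \<le> f y"
      and unb: "\<forall>m. \<exists>\<beta>\<in>{0<..<L}. \<forall>y\<in>{-L<..<L}. \<beta> \<le> \<bar>y\<bar> \<longrightarrow> m \<le> f y"
      by (elim exE conjE) (rule that; assumption)
    \<comment> \<open>Oddness of \<open>h\<close> preserves the drift under reflection, and
      \<open>f\<close> is not tied to a starting point, so the same \<open>f\<close> and
      \<open>u\<close> serve both ends.\<close>
    have lsol': "logit_solution M L (logit_drift g) (- y0) (\<lambda>t \<omega>. - N t \<omega>) (\<lambda>t \<omega>. - Y t \<omega>) \<tau>"
      using lsol logit_drift_minus by (rule logit_solution_uminus)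
    have y0': "- y0 \<in> {-L<..<L}" using y0 by auto
    have "AE \<omega> in M. \<exists>b<L. \<forall>t. 0 \<le> t \<and> t \<le> T \<and> ereal t < \<tau> \<omega> \<longrightarrow> Y t \<omega> \<le> b" if "0 < T" for T
      by (rule nonexplosion_upper[OF noise lsol that h y0, of f u]) (use fu unb in auto)
    moreover have "AE \<omega> in M. \<exists>b<L. \<forall>t. 0 \<le> t \<and> t \<le> T \<and> ereal t < \<tau> \<omega> \<longrightarrow> - Y t \<omega> \<le> b" if "0 < T" for T
      by (rule nonexplosion_upper[OF noise_uminus[OF noise] lsol' that h y0', of f u]) (use fu unb in auto)
    ultimately have "AE \<omega> in M. \<tau> \<omega> = \<infinity>"
      unfolding L_def Y_def by (rule market_survives[OF \<delta> gc BM sol])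
    with sol[unfolded market_solution_def] show "delta_diverse M \<delta> X \<tau>"
      unfolding delta_diverse_def
      by eventually_elim (auto simp: market_domain_def mu_def)
  qed
qed

end
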